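(* Let $n\geq 0$ and $0\leq k\leq \lfloor n/2\rfloor$ be integers. Let $\mathcal{R}(n,k)$ be the set of partial matchings of $[n]$ with exactly $k$ arcs, no neighbor alignments, no left nestings and no right nestings, and let $\mathcal{T}(n-k+1,k)$ be the set of partitions of $[n-k+1]$ with exactly $k$ arcs and no right nestings. Then there exists a bijection $\gamma:\mathcal{R}(n,k)\to\mathcal{T}(n-k+1,k)$ such that, for every $M\in\mathcal{R}(n,k)$, the number of left crossings of $M$ equals the number of transients of $\gamma(M)$.
   Context: Write $[n]=\{1,2,\ldots,n\}$, with $[0]=\emptyset$. A partition $\pi$ of $[n]$ (set partition into nonempty blocks) is represented by a diagram with vertices $1,\ldots,n$: for each block $B=\{i_1<i_2<\cdots<i_m\}$ one draws the arcs $(i_1,i_2),(i_2,i_3),\ldots,(i_{m-1},i_m)$; these are the arcs of $\pi$. A partial matching of $[n]$ is a partition of $[n]$ in which each block has at most two elements. For two arcs $(i_1,j_1),(i_2,j_2)$ of a partition: they form a neighbor alignment if $i_1<j_1<i_2<j_2$ and $j_1+1=i_2$; a left nesting if $i_1<i_2<j_2<j_1$ and $i_1+1=i_2$; a right nesting if $i_1<i_2<j_2<j_1$ and $j_2+1=j_1$; a left crossing if $i_1<i_2<j_1<j_2$ and $i_1+1=i_2$. The number of left crossings is the number of pairs of arcs forming a left crossing. A transient of a partition is an element of a block with at least two elements that is neither the minimum nor the maximum of that block. *)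

theory Defs
  imports "HOL-Library.Disjoint_Sets"
begin

abbreviation set_partition :: "nat \<Rightarrow> nat set set \<Rightarrow> bool" where
  "set_partition n P \<equiv> partition_on {1..n} P"

definition arcs :: "nat set set \<Rightarrow> (nat \<times> nat) set" where
  "arcs P = {(i, j). \<exists>B\<in>P. i \<in> B \<and> j \<in> B \<and> i < j \<and> (\<forall>m\<in>B. \<not> (i < m \<and> m < j))}"

definition partial_matching :: "nat \<Rightarrow> nat set set \<Rightarrow> bool" where
  "partial_matching n P \<longleftrightarrow> set_partition n P \<and> (\<forall>B\<in>P. card B \<le> 2)"

fun neighbor_alignment :: "nat \<times> nat \<Rightarrow> nat \<times> nat \<Rightarrow> bool" where
  "neighbor_alignment (i1, j1) (i2, j2) \<longleftrightarrow> i1 < j1 \<and> j1 < i2 \<and> i2 < j2 \<and> j1 + 1 = i2"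

fun left_nesting :: "nat \<times> nat \<Rightarrow> nat \<times> nat \<Rightarrow> bool" where
  "left_nesting (i1, j1) (i2, j2) \<longleftrightarrow> i1 < i2 \<and> i2 < j2 \<and> j2 < j1 \<and> i1 + 1 = i2"

fun right_nesting :: "nat \<times> nat \<Rightarrow> nat \<times> nat \<Rightarrow> bool" where
  "right_nesting (i1, j1) (i2, j2) \<longleftrightarrow> i1 < i2 \<and> i2 < j2 \<and> j2 < j1 \<and> j2 + 1 = j1"

fun left_crossing :: "nat \<times> nat \<Rightarrow> nat \<times> nat \<Rightarrow> bool" where
  "left_crossing (i1, j1) (i2, j2) \<longleftrightarrow> i1 < i2 \<and> i2 < j1 \<and> j1 < j2 \<and> i1 + 1 = i2"

text \<open>The relation \<open>left_crossing\<close> is asymmetric, so every unordered pair of arcs forming a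
  left crossing is counted exactly once by the ordered pairs below.\<close>

definition num_left_crossings :: "nat set set \<Rightarrow> nat" where
  "num_left_crossings P = card {(a, b). a \<in> arcs P \<and> b \<in> arcs P \<and> left_crossing a b}"

definition transients :: "nat set set \<Rightarrow> nat set" where
  "transients P = {x. \<exists>B\<in>P. x \<in> B \<and> card B \<ge> 2 \<and> x \<noteq> Min B \<and> x \<noteq> Max B}"

definition R_matchings :: "nat \<Rightarrow> nat \<Rightarrow> nat set set set" where
  "R_matchings n k = {M. partial_matching n M \<and> card (arcs M) = k \<and>
     (\<forall>a\<in>arcs M. \<forall>b\<in>arcs M.
        \<not> neighbor_alignment a b \<and> \<not> left_nesting a b \<and> \<not> right_nesting a b)}"

definition T_partitions :: "nat \<Rightarrow> nat \<Rightarrow> nat set set set" where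
  "T_partitions m k = {P. set_partition m P \<and> card (arcs P) = k \<and>
     (\<forall>a\<in>arcs P. \<forall>b\<in>arcs P. \<not> right_nesting a b)}"

end

theory Submission
  imports Defs
begin

text \<open>Replace a partition by its set of arcs. Partitions without right nestings are built from left to
  right: the next vertex is a new block minimum or is attached to the last element of a block, and
  absence of right nestings says that within a run of consecutive attachments the positions of these
  last elements, in increasing order, weakly increase. The matchings are built likewise: append a
  singleton, or append a closer and insert its opener at the end of the run of openers following some
  singleton (or the beginning). The conditions say that the runs of openers chosen at consecutive
  closers weakly increase. Hence both families are encoded by the same words.

  Label each slot by the order of its creation. Then the number of left crossings is \<open>k\<close> minus the
  number of labels used by the word, where labels never move, and the number of transients is \<open>k\<close> minus
  the number of labels used when each used label moves to the end of the list. In both cases the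
  words using a prescribed set of labels in each run satisfy the same recursion, since the first
  letter of a run is forced and its label either recurs in the run or not; so the two sets of used
  labels are equidistributed.\<close>

section \<open>Partitions and their arcs\<close>

text \<open>Reading one word in both families does not carry left crossings to transients: the word
  \<open>[None, Some 0, Some 0]\<close> uses one label when labels stay in place and two when used
  labels move to the end. So only the numbers of words with a given set of used labels are compared,
  and the bijection is glued from bijections between these fibres. The counts come from what a label
  stands for. In a partition it stands for a block; a block with r >= 2 elements has r - 1 arcs and
  r - 2 transients, so transients are arcs minus non-singleton blocks. In a matching it stands for a
  place that can hold a run of openers; left crossings are adjacent openers, so they are arcs minus
  nonempty runs of openers. The used labels have to be tracked as a set, since different runs may
  use the same label and sizes do not determine the size of a union. Within the current run,
  however, only the number of labels matters, and this makes the recursion insensitive to the order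
  of the list.\<close>

definition arc_diagram :: "nat \<Rightarrow> (nat \<times> nat) set \<Rightarrow> bool" where
  "arc_diagram n E \<longleftrightarrow> (\<forall>(i, j)\<in>E. 1 \<le> i \<and> i < j \<and> j \<le> n) \<and> single_valued E \<and> single_valued (E\<inverse>)"

definition diagram_blocks :: "nat \<Rightarrow> (nat \<times> nat) set \<Rightarrow> nat set set" where
  "diagram_blocks n E = (\<lambda>x. {y. (x, y) \<in> (E \<union> E\<inverse>)\<^sup>*}) ` {1..n}"

lemma arc_diagramD:
  assumes "arc_diagram n E" "(i, j) \<in> E"
  shows "1 \<le> i" "i < j" "j \<le> n"
  using assms by (auto simp: arc_diagram_def)

lemma arc_diagram_right_unique: "arc_diagram n E \<Longrightarrow> (i, j) \<in> E \<Longrightarrow> (i, j') \<in> E \<Longrightarrow> j = j'"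
  by (auto simp: arc_diagram_def single_valued_def)

lemma arc_diagram_left_unique: "arc_diagram n E \<Longrightarrow> (i, j) \<in> E \<Longrightarrow> (i', j) \<in> E \<Longrightarrow> i = i'"
  by (auto simp: arc_diagram_def single_valued_def)

lemma arc_diagram_finite: "arc_diagram n E \<Longrightarrow> finite E"
  by (rule finite_subset[of _ "{1..n} \<times> {1..n}"]) (fastforce simp: arc_diagram_def)+

lemma set_partition_finite:
  assumes "set_partition n P" "B \<in> P"
  shows "finite B" "B \<subseteq> {1..n}"
proof -
  show "B \<subseteq> {1..n}"
    using assms by (auto simp: partition_on_def)
  then show "finite B"
    by (rule finite_subset) simp
qed

lemma set_partition_block_eq:
  assumes "set_partition n P" "B \<in> P" "C \<in> P" "x \<in> B" "x \<in> C"
  shows "B = C"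
  using assms by (metis disjointD disjoint_iff partition_on_def)

lemma in_arcs_block:
  assumes "set_partition n P" "B \<in> P" "i \<in> B \<or> j \<in> B"
  shows "(i, j) \<in> arcs P \<longleftrightarrow> i \<in> B \<and> j \<in> B \<and> i < j \<and> (\<forall>m\<in>B. \<not> (i < m \<and> m < j))"
  using assms set_partition_block_eq[OF assms(1)] unfolding arcs_def by blast

lemma arc_to_if_smaller:
  assumes "set_partition n P" "B \<in> P" "x \<in> B" "y \<in> B" "x < y"
  obtains z where "z \<in> B" "x \<le> z" "z < y" "(z, y) \<in> arcs P"
proof -
  let ?S = "{m\<in>B. m < y}"
  have fin: "finite ?S" and ne: "?S \<noteq> {}"
    using assms set_partition_finite by auto
  have z: "Max ?S \<in> ?S" "x \<le> Max ?S"
    using Max_in[OF fin ne] fin assms by auto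
  have "\<not> (Max ?S < m \<and> m < y)" if "m \<in> B" for m
    using Max_ge[OF fin, of m] that by (auto simp: not_less)
  then have "(Max ?S, y) \<in> arcs P"
    using in_arcs_block[OF assms(1,2), of "Max ?S" y] z assms by blast
  then show ?thesis
    using that z by blast
qed

lemma arc_from_if_greater:
  assumes "set_partition n P" "B \<in> P" "x \<in> B" "y \<in> B" "x < y"
  obtains z where "z \<in> B" "(x, z) \<in> arcs P"
proof -
  let ?S = "{m\<in>B. x < m}"
  have fin: "finite ?S" and ne: "?S \<noteq> {}"
    using assms set_partition_finite by auto
  have z: "Min ?S \<in> ?S"
    using Min_in[OF fin ne] .
  have "\<not> (x < m \<and> m < Min ?S)" if "m \<in> B" for m
    using Min_le[OF fin, of m] that by fastforce
  then have "(x, Min ?S) \<in> arcs P"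
    using in_arcs_block[OF assms(1,2), of x "Min ?S"] z assms by blast
  then show ?thesis
    using that z by blast
qed

lemma arc_diagram_arcs:
  assumes "set_partition n P"
  shows "arc_diagram n (arcs P)"
proof -
  have "1 \<le> i \<and> i < j \<and> j \<le> n" if "(i, j) \<in> arcs P" for i j
    using that set_partition_finite(2)[OF assms] unfolding arcs_def by fastforce
  moreover have "j = j'" if "(i, j) \<in> arcs P" "(i, j') \<in> arcs P" for i j j'
  proof -
    obtain B where "B \<in> P" "i \<in> B"
      using \<open>(i, j) \<in> arcs P\<close> by (auto simp: arcs_def)
    then show ?thesis
      using in_arcs_block[OF assms, of B i] that by (metis linorder_neqE_nat)
  qed
  moreover have "i = i'" if "(i, j) \<in> arcs P" "(i', j) \<in> arcs P" for i i' j
  proof -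
    obtain B where "B \<in> P" "j \<in> B"
      using \<open>(i, j) \<in> arcs P\<close> by (auto simp: arcs_def)
    then show ?thesis
      using in_arcs_block[OF assms, of B _ j] that by (metis linorder_neqE_nat)
  qed
  ultimately show ?thesis
    by (fastforce simp: arc_diagram_def single_valued_def)
qed

lemma block_rtrancl_arcs:
  assumes "set_partition n P" "B \<in> P" "x \<in> B" "y \<in> B" "x \<le> y"
  shows "(x, y) \<in> (arcs P)\<^sup>*"
  using assms(4,5)
proof (induction y rule: less_induct)
  case (less y)
  show ?case
  proof (cases "x = y")
    case False
    with less.prems obtain z where "z \<in> B" "x \<le> z" "z < y" "(z, y) \<in> arcs P"
      using arc_to_if_smaller[OF assms(1-3)] by (metis le_neq_implies_less)
    then show ?thesis
      using less.IH by (meson rtrancl.rtrancl_into_rtrancl)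
  qed simp
qed

lemma block_eq_connected:
  assumes "set_partition n P" "B \<in> P" "x \<in> B"
  shows "{y. (x, y) \<in> (arcs P \<union> (arcs P)\<inverse>)\<^sup>*} = B"
proof (intro equalityI subsetI CollectI)
  fix y assume "y \<in> {y. (x, y) \<in> (arcs P \<union> (arcs P)\<inverse>)\<^sup>*}"
  then have "(x, y) \<in> (arcs P \<union> (arcs P)\<inverse>)\<^sup>*"
    by simp
  then show "y \<in> B"
    by (induction rule: rtrancl_induct) (use assms in_arcs_block in \<open>blast+\<close>)
next
  fix y assume "y \<in> B"
  then have "(x, y) \<in> (arcs P)\<^sup>* \<or> (y, x) \<in> (arcs P)\<^sup>*"
    using block_rtrancl_arcs[OF assms(1,2)] assms(3) by (meson nat_le_linear)
  then show "(x, y) \<in> (arcs P \<union> (arcs P)\<inverse>)\<^sup>*"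
    by (metis (no_types, lifting) converse_iff in_rtrancl_UnI rtrancl_converse)
qed

lemma diagram_blocks_arcs:
  assumes "set_partition n P"
  shows "diagram_blocks n (arcs P) = P"
proof -
  have cov: "\<Union>P = {1..n}" and ne: "{} \<notin> P"
    using assms by (auto simp: partition_on_def)
  show ?thesis
  proof (intro equalityI subsetI)
    fix B assume "B \<in> diagram_blocks n (arcs P)"
    then obtain x where "x \<in> {1..n}" "B = {y. (x, y) \<in> (arcs P \<union> (arcs P)\<inverse>)\<^sup>*}"
      by (auto simp: diagram_blocks_def)
    then show "B \<in> P"
      using cov block_eq_connected[OF assms] by (metis UnionE)
  next
    fix B assume "B \<in> P"
    then obtain x where "x \<in> B" "x \<in> {1..n}"
      using ne cov by (metis UnionI ex_in_conv)
    then show "B \<in> diagram_blocks n (arcs P)"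
      using block_eq_connected[OF assms \<open>B \<in> P\<close> \<open>x \<in> B\<close>] unfolding diagram_blocks_def by (intro image_eqI) auto
  qed
qed

text \<open>A vertex has at most one incoming and at most one outgoing arc, so a path that changes
  direction has to retrace the arc just used. Components are therefore directed paths.\<close>

lemma connected_imp_directed:
  assumes "arc_diagram n E" "(x, y) \<in> (E \<union> E\<inverse>)\<^sup>*"
  shows "(x, y) \<in> E\<^sup>* \<or> (y, x) \<in> E\<^sup>*"
  using assms(2)
proof (induction rule: rtrancl_induct)
  case (step y z)
  show ?case
  proof (cases "(y, z) \<in> E")
    case yz: True
    show ?thesis
    proof (cases "(x, y) \<in> E\<^sup>*")
      case True
      then show ?thesis
        using yz by (meson rtrancl.rtrancl_into_rtrancl)
    next
      case False
      then have "(y, x) \<in> E\<^sup>*" "x \<noteq> y"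
        using step by auto
      then obtain w where "(y, w) \<in> E" "(w, x) \<in> E\<^sup>*"
        by (metis converse_rtranclE)
      then show ?thesis
        using arc_diagram_right_unique[OF assms(1) yz] by blast
    qed
  next
    case False
    then have zy: "(z, y) \<in> E"
      using step by auto
    show ?thesis
    proof (cases "(y, x) \<in> E\<^sup>*")
      case True
      then show ?thesis
        using zy by (meson converse_rtrancl_into_rtrancl)
    next
      case False
      then have "(x, y) \<in> E\<^sup>*" "x \<noteq> y"
        using step by auto
      then obtain w where "(w, y) \<in> E" "(x, w) \<in> E\<^sup>*"
        by (metis rtranclE)
      then show ?thesis
        using arc_diagram_left_unique[OF assms(1) zy] by blast
    qed
  qed
qed simp

lemma diagram_rtrancl_le:
  assumes "arc_diagram n E" "(x, y) \<in> E\<^sup>*"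
  shows "x \<le> y"
  using assms(2) by (induction rule: rtrancl_induct) (use arc_diagramD[OF assms(1)] in \<open>fastforce+\<close>)

lemma connected_in_range:
  assumes "arc_diagram n E" "(x, y) \<in> (E \<union> E\<inverse>)\<^sup>*" "x \<in> {1..n}"
  shows "y \<in> {1..n}"
  using assms(2) by (induction rule: rtrancl_induct)
    (use assms(3) arc_diagramD[OF assms(1)] in \<open>fastforce+\<close>)

lemma diagram_blocks_partition:
  assumes "arc_diagram n E"
  shows "set_partition n (diagram_blocks n E)"
proof (rule partition_onI)
  show "\<Union>(diagram_blocks n E) = {1..n}"
    using connected_in_range[OF assms] unfolding diagram_blocks_def by blast
  show "{} \<notin> diagram_blocks n E"
    by (auto simp: diagram_blocks_def)
  show "disjnt B C" if BC: "B \<in> diagram_blocks n E" "C \<in> diagram_blocks n E" "B \<noteq> C" for B C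
  proof (rule ccontr)
    let ?R = "(E \<union> E\<inverse>)\<^sup>*"
    have sym: "sym ?R"
      by (simp add: sym_rtrancl sym_Un_converse)
    assume "\<not> disjnt B C"
    then obtain x y z where "B = {w. (x, w) \<in> ?R}" "C = {w. (y, w) \<in> ?R}" "(x, z) \<in> ?R" "(y, z) \<in> ?R"
      using BC(1,2) unfolding diagram_blocks_def disjnt_iff by blast
    moreover from this have "(x, w) \<in> ?R \<longleftrightarrow> (y, w) \<in> ?R" for w
      by (meson rtrancl_trans symD[OF sym])
    ultimately show False
      using \<open>B \<noteq> C\<close> by simp
  qed
qed

lemma arcs_diagram_blocks:
  assumes "arc_diagram n E"
  shows "arcs (diagram_blocks n E) = E"
proof -
  let ?P = "diagram_blocks n E" and ?R = "(E \<union> E\<inverse>)\<^sup>*"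
  have part: "set_partition n ?P"
    using diagram_blocks_partition[OF assms] .
  have "(i, j) \<in> arcs ?P \<longleftrightarrow> (i, j) \<in> E" for i j
  proof
    assume "(i, j) \<in> E"
    define B where "B = {y. (i, y) \<in> ?R}"
    have B: "B \<in> ?P" "i \<in> B" "j \<in> B"
      using arc_diagramD[OF assms \<open>(i, j) \<in> E\<close>] \<open>(i, j) \<in> E\<close>
      by (auto simp: B_def diagram_blocks_def)
    moreover have "\<not> (i < m \<and> m < j)" if m: "m \<in> B" for m
    proof
      assume im: "i < m \<and> m < j"
      then have "(i, m) \<in> E\<^sup>*"
        using connected_imp_directed[OF assms, of i m] m diagram_rtrancl_le[OF assms, of m i]
        by (auto simp: B_def)
      \<comment> \<open>The path from \<open>i\<close> to \<open>m\<close> begins with the only arc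
        leaving \<open>i\<close>, so it visits \<open>j\<close> no later than
        \<open>m\<close>.\<close>
      then obtain w where "(i, w) \<in> E" "(w, m) \<in> E\<^sup>*"
        using im by (metis converse_rtranclE less_irrefl)
      then have "j \<le> m"
        using arc_diagram_right_unique[OF assms \<open>(i, j) \<in> E\<close>] diagram_rtrancl_le[OF assms] by blast
      with im show False
        by simp
    qed
    ultimately show "(i, j) \<in> arcs ?P"
      using in_arcs_block[OF part B(1), of i j] arc_diagramD[OF assms \<open>(i, j) \<in> E\<close>] by blast
  next
    assume "(i, j) \<in> arcs ?P"
    then obtain B where B: "B \<in> ?P" "i \<in> B" "j \<in> B" "i < j" "\<forall>m\<in>B. \<not> (i < m \<and> m < j)"
      by (auto simp: arcs_def)
    then obtain x where x: "x \<in> {1..n}" "B = {y. (x, y) \<in> ?R}"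
      by (auto simp: diagram_blocks_def)
    have "sym ?R"
      by (simp add: sym_rtrancl sym_Un_converse)
    then have "(i, j) \<in> ?R"
      using x B by (metis (mono_tags, lifting) mem_Collect_eq rtrancl_trans symD)
    then have "(i, j) \<in> E\<^sup>*"
      using connected_imp_directed[OF assms] diagram_rtrancl_le[OF assms, of j i] \<open>i < j\<close> by auto
    then obtain w where w: "(i, w) \<in> E" "(w, j) \<in> E\<^sup>*"
      using \<open>i < j\<close> by (metis converse_rtranclE less_irrefl)
    then have "w \<in> B"
      using x B by (auto intro: rtrancl.rtrancl_into_rtrancl)
    then have "w = j"
      using B w arc_diagramD[OF assms] diagram_rtrancl_le[OF assms] by (meson le_neq_implies_less)
    then show "(i, j) \<in> E"
      using w by simp
  qed
  then show ?thesis
    by auto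
qed

lemma bij_betw_arcs: "bij_betw arcs {P. set_partition n P} {E. arc_diagram n E}"
  by (rule bij_betw_byWitness[where f' = "diagram_blocks n"])
    (simp_all add: diagram_blocks_arcs arcs_diagram_blocks arc_diagram_arcs diagram_blocks_partition image_subset_iff del: One_nat_def)

section \<open>Transients and matchings in terms of arcs\<close>

lemma transients_eq:
  assumes "set_partition n P"
  shows "transients P = Domain (arcs P) \<inter> Range (arcs P)"
proof (intro equalityI subsetI)
  fix x assume "x \<in> transients P"
  then obtain B where B: "B \<in> P" "x \<in> B" "x \<noteq> Min B" "x \<noteq> Max B"
    by (auto simp: transients_def)
  note fin = set_partition_finite(1)[OF assms B(1)]
  have "Min B \<in> B" "Min B < x" "Max B \<in> B" "x < Max B"
    using B fin Min_in[OF fin] Max_in[OF fin] by (auto simp: le_neq_implies_less simp del: Min_in Max_in)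
  then show "x \<in> Domain (arcs P) \<inter> Range (arcs P)"
    using arc_to_if_smaller[OF assms B(1), of "Min B" x] arc_from_if_greater[OF assms B(1), of x "Max B"] B
    by (metis DomainI IntI RangeI)
next
  fix x assume "x \<in> Domain (arcs P) \<inter> Range (arcs P)"
  then obtain i j where "(i, x) \<in> arcs P" "(x, j) \<in> arcs P"
    by auto
  moreover from this obtain B where B: "B \<in> P" "x \<in> B"
    by (auto simp: arcs_def)
  ultimately have ij: "i \<in> B" "i < x" "j \<in> B" "x < j"
    using in_arcs_block[OF assms B(1)] by blast+
  note fin = set_partition_finite(1)[OF assms B(1)]
  have "card {i, x} \<le> card B"
    using ij B fin by (intro card_mono) auto
  moreover have "Min B \<le> i" "j \<le> Max B"
    using ij fin by auto
  ultimately show "x \<in> transients P"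
    using ij B by (auto simp: transients_def intro!: bexI[of _ B])
qed

text \<open>A third element of a block lies strictly between its minimum and maximum; without
  transients a block is contained in the set of its two extremes.\<close>

lemma partial_matching_iff_no_transients:
  assumes "set_partition n P"
  shows "partial_matching n P \<longleftrightarrow> transients P = {}"
proof -
  have "card B \<le> 2 \<longleftrightarrow> transients P \<inter> B = {}" if B: "B \<in> P" for B
  proof
    note fin = set_partition_finite(1)[OF assms B]
    assume "card B \<le> 2"
    show "transients P \<inter> B = {}"
    proof (rule ccontr)
      assume "transients P \<inter> B \<noteq> {}"
      then obtain x where x: "x \<in> B" "x \<noteq> Min B" "x \<noteq> Max B"
        using B set_partition_block_eq[OF assms] by (fastforce simp: transients_def)
      then have "Min B < x" "x < Max B"
        using fin by (auto simp: le_neq_implies_less)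
      then have "card {Min B, x, Max B} = 3" "{Min B, x, Max B} \<subseteq> B"
        using x fin Min_in[OF fin] Max_in[OF fin] by (auto simp del: Min_in Max_in)
      then show False
        using card_mono[OF fin, of "{Min B, x, Max B}"] \<open>card B \<le> 2\<close> by linarith
    qed
  next
    assume "transients P \<inter> B = {}"
    then show "card B \<le> 2"
    proof (cases "card B \<ge> 2")
      case True
      then have "B \<subseteq> {Min B, Max B}"
        using \<open>transients P \<inter> B = {}\<close> B by (auto simp: transients_def)
      then have "card B \<le> card {Min B, Max B}"
        by (intro card_mono) auto
      then show ?thesis
        by (simp add: card_insert_if split: if_splits)
    qed simp
  qed
  moreover have "transients P \<subseteq> \<Union>P"
    by (auto simp: transients_def)
  ultimately have "(\<forall>B\<in>P. card B \<le> 2) \<longleftrightarrow> transients P = {}"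
    by blast
  then show ?thesis
    using assms by (simp add: partial_matching_def)
qed

section \<open>Words and the labels they use\<close>

text \<open>The letter \<open>None\<close> creates a slot and starts a new run, \<open>Some p\<close> uses the slot at position \<open>p\<close>. The
  list \<open>L\<close> below holds the labels of the slots by position, and \<open>g\<close> says how a use of position \<open>p\<close>
  rearranges it.\<close>

fun growth_word :: "nat \<Rightarrow> nat \<Rightarrow> nat option list \<Rightarrow> bool" where
  "growth_word t q [] \<longleftrightarrow> True"
| "growth_word t q (None # ws) \<longleftrightarrow> growth_word (Suc t) 0 ws"
| "growth_word t q (Some p # ws) \<longleftrightarrow> q \<le> p \<and> p < t \<and> growth_word t p ws"

fun first_run :: "(nat \<Rightarrow> nat list \<Rightarrow> nat list) \<Rightarrow> nat list \<Rightarrow> nat option list \<Rightarrow> nat set" where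
  "first_run g L [] = {}"
| "first_run g L (None # ws) = {}"
| "first_run g L (Some p # ws) = insert (L ! p) (first_run g (g p L) ws)"

text \<open>A new slot is labelled by \<open>length L\<close>, the number of slots before it. Two
  choices of \<open>g\<close> thus hand out the same labels at the same letters and differ only in
  the order of the list.\<close>

fun later_runs :: "(nat \<Rightarrow> nat list \<Rightarrow> nat list) \<Rightarrow> nat list \<Rightarrow> nat option list \<Rightarrow> nat set" where
  "later_runs g L [] = {}"
| "later_runs g L (None # ws) =
     first_run g (L @ [length L]) ws \<union> later_runs g (L @ [length L]) ws"
| "later_runs g L (Some p # ws) = later_runs g (g p L) ws"

definition num_runs :: "nat option list \<Rightarrow> nat" where
  "num_runs ws = length (filter (\<lambda>x. x = None) ws)"

lemma num_runs_simps [simp]: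
  "num_runs [] = 0" "num_runs (None # ws) = Suc (num_runs ws)" "num_runs (Some p # ws) = num_runs ws"
  "num_runs (ws @ ws') = num_runs ws + num_runs ws'"
  by (simp_all add: num_runs_def)

text \<open>The current run is kept apart from the later ones because the comparison treats them
  differently: \<open>A\<close> may be replaced by a set of the same size, whereas \<open>D\<close>
  has to be the same on both sides.\<close>

definition run_words ::
  "(nat \<Rightarrow> nat list \<Rightarrow> nat list) \<Rightarrow> nat list \<Rightarrow> nat \<Rightarrow> nat \<Rightarrow> nat \<Rightarrow> nat set \<Rightarrow> nat set \<Rightarrow> nat option list set" where
  "run_words g L q l c A D = {ws. growth_word (length L) q ws \<and> length ws = l \<and> num_runs ws = c \<and>
     first_run g L ws = A \<and> later_runs g L ws = D}"

text \<open>Common ground of both systems: using position \<open>p\<close> may permute labels only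
  so that those from \<open>p\<close> on, which are the ones still available in the current run,
  remain the same set.\<close>

definition relabelling :: "(nat \<Rightarrow> nat list \<Rightarrow> nat list) \<Rightarrow> bool" where
  "relabelling g \<longleftrightarrow> (\<forall>p L. distinct L \<longrightarrow> p < length L \<longrightarrow> distinct (g p L) \<and>
     length (g p L) = length L \<and> set (g p L) = set L \<and> set (drop p (g p L)) = set (drop p L))"

lemma relabellingD:
  assumes "relabelling g" "distinct L" "p < length L"
  shows "distinct (g p L)" "length (g p L) = length L" "set (g p L) = set L"
    "set (drop p (g p L)) = set (drop p L)"
  using assms by (auto simp: relabelling_def)

lemma in_set_drop_iff: "x \<in> set (drop q L) \<longleftrightarrow> (\<exists>p\<ge>q. p < length L \<and> L ! p = x)"
proof
  assume "x \<in> set (drop q L)"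
  then obtain i where "i < length L - q" "L ! (q + i) = x"
    by (auto simp: in_set_conv_nth)
  then show "\<exists>p\<ge>q. p < length L \<and> L ! p = x"
    by (intro exI[of _ "q + i"]) auto
next
  assume "\<exists>p\<ge>q. p < length L \<and> L ! p = x"
  then obtain p where "p \<ge> q" "p < length L" "L ! p = x"
    by auto
  then show "x \<in> set (drop q L)"
    by (auto simp: in_set_conv_nth intro!: exI[of _ "p - q"])
qed

lemma growth_word_entries:
  "growth_word t q ws \<Longrightarrow> set ws \<subseteq> insert None (Some ` {..<t + length ws})"
proof (induction t q ws rule: growth_word.induct)
  case (2 t q ws)
  then show ?case by auto
next
  case (3 t q p ws)
  then have "set ws \<subseteq> insert None (Some ` {..<t + length ws})"
    by simp
  also have "\<dots> \<subseteq> insert None (Some ` {..<t + length (Some p # ws)})"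
    by auto
  finally show ?case
    using 3 by auto
qed simp

lemma finite_growth_words: "finite {ws. growth_word t q ws \<and> length ws = l}"
proof (rule finite_subset)
  show "{ws. growth_word t q ws \<and> length ws = l} \<subseteq>
      {ws. set ws \<subseteq> insert None (Some ` {..<t + l}) \<and> length ws = l}"
    using growth_word_entries by blast
  show "finite {ws. set ws \<subseteq> insert None (Some ` {..<t + l}) \<and> length ws = l}"
    by (intro finite_lists_length_eq) simp
qed

lemma finite_run_words: "finite (run_words g L q l c A D)"
  by (rule finite_subset[OF _ finite_growth_words[of "length L" q l]]) (auto simp: run_words_def)

lemma finite_first_run: "finite (first_run g L ws)"
  by (induction g L ws rule: first_run.induct) auto

lemma finite_later_runs: "finite (later_runs g L ws)"
  by (induction g L ws rule: later_runs.induct) (auto simp: finite_first_run)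

text \<open>Positions do not drop below \<open>q\<close> within a run, and no use of a position
  brings a label from its left to its right.\<close>

lemma first_run_subset:
  assumes "relabelling g"
  shows "distinct L \<Longrightarrow> growth_word (length L) q ws \<Longrightarrow> first_run g L ws \<subseteq> set (drop q L)"
proof (induction ws arbitrary: L q)
  case (Cons w ws)
  show ?case
  proof (cases w)
    case (Some p)
    then have p: "q \<le> p" "p < length L" and ws: "growth_word (length L) p ws"
      using Cons.prems by auto
    note g = relabellingD[OF assms Cons.prems(1) p(2)]
    have "first_run g (g p L) ws \<subseteq> set (drop p L)"
      using Cons.IH[of "g p L" p] g ws by simp
    also have "\<dots> \<subseteq> set (drop q L)"
      using p by (simp add: set_drop_subset_set_drop)
    finally show ?thesis
      using p Some by (auto simp: in_set_drop_iff)
  qed simp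
qed simp

text \<open>The first letter of a run hitting the labels \<open>A\<close> is the leftmost entry of \<open>L\<close> in \<open>A\<close>, because
  positions weakly increase within a run and entries left of the current position stay put.\<close>

lemma run_words_Suc:
  assumes g: "relabelling g" and L: "distinct L"
    and p: "q \<le> p" "p < length L" "L ! p \<in> A" "\<And>r. q \<le> r \<Longrightarrow> r < p \<Longrightarrow> L ! r \<notin> A"
  shows "run_words g L q (Suc l) c A D =
    Cons (Some p) ` (run_words g (g p L) p l c A D \<union> run_words g (g p L) p l c (A - {L ! p}) D)"
    (is "?l = ?r")
proof (intro equalityI subsetI)
  fix ws assume ws: "ws \<in> ?l"
  then obtain w us where wus: "ws = w # us"
    by (auto simp: run_words_def length_Suc_conv)
  obtain r where r: "w = Some r"
    using ws wus p(3) by (cases w) (auto simp: run_words_def)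
  have props: "q \<le> r" "r < length L" "growth_word (length L) r us"
    "A = insert (L ! r) (first_run g (g r L) us)"
    using ws wus r by (auto simp: run_words_def)
  note gr = relabellingD[OF g L props(2)]
  have "first_run g (g r L) us \<subseteq> set (drop r L)"
    using first_run_subset[OF g gr(1), of r us] gr props by simp
  moreover have "L ! r \<in> set (drop r L)"
    using props by (auto simp: in_set_drop_iff)
  ultimately have "L ! p \<in> set (drop r L)"
    using props(4) p(3) by (metis insert_iff subsetD)
  then obtain s where "s \<ge> r" "s < length L" "L ! s = L ! p"
    unfolding in_set_drop_iff by blast
  then have "r \<le> p"
    using L p by (simp add: nth_eq_iff_index_eq)
  moreover have "\<not> r < p"
    using p(4)[of r] props by auto
  ultimately have "r = p"
    by simp
  have "first_run g (g r L) us = A \<or> first_run g (g r L) us = A - {L ! r}"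
    using props(4) by auto
  then have "us \<in> run_words g (g r L) r l c A D \<union> run_words g (g r L) r l c (A - {L ! r}) D"
    using ws wus r props(3) gr(2) by (simp add: run_words_def)
  then show "ws \<in> ?r"
    using wus r \<open>r = p\<close> by simp
next
  note gp = relabellingD[OF g L p(2)]
  fix ws assume "ws \<in> ?r"
  then obtain us where "ws = Some p # us"
    "us \<in> run_words g (g p L) p l c A D \<union> run_words g (g p L) p l c (A - {L ! p}) D"
    by blast
  then have us: "ws = Some p # us" "growth_word (length L) p us" "length us = l" "num_runs us = c"
    "first_run g (g p L) us = A \<or> first_run g (g p L) us = A - {L ! p}" "later_runs g (g p L) us = D"
    using gp(2) by (simp_all add: run_words_def) blast+
  then have "insert (L ! p) (first_run g (g p L) us) = A"
    using p(3) by auto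
  then show "ws \<in> ?l"
    using p us by (simp add: run_words_def)
qed

text \<open>If the current run uses no label, a nonempty word starts with \<open>None\<close>, which
  makes all positions available again. The labels \<open>D\<close> then come from the next run and
  from the runs after it; the two parts may overlap, hence the union over all pairs.\<close>

lemma run_words_Suc_empty:
  "run_words g L q (Suc l) c {} D = (if c = 0 then {} else
     Cons None ` (\<Union>(A', D')\<in>{(A', D'). A' \<union> D' = D}. run_words g (L @ [length L]) 0 l (c - 1) A' D'))"
    (is "_ = ?r")
proof (intro equalityI subsetI)
  let ?M = "L @ [length L]"
  fix ws assume ws: "ws \<in> run_words g L q (Suc l) c {} D"
  then obtain us where us: "ws = None # us"
    unfolding run_words_def by (cases ws; cases "hd ws") auto
  with ws have "c \<noteq> 0" "first_run g ?M us \<union> later_runs g ?M us = D"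
    "us \<in> run_words g ?M 0 l (c - 1) (first_run g ?M us) (later_runs g ?M us)"
    by (auto simp: run_words_def)
  then show "ws \<in> ?r"
    using us by auto
next
  let ?M = "L @ [length L]"
  fix ws assume "ws \<in> ?r"
  then obtain us A' D' where "ws = None # us" "us \<in> run_words g ?M 0 l (c - 1) A' D'"
    "A' \<union> D' = D" "c \<noteq> 0"
    by (auto split: if_splits)
  then show "ws \<in> run_words g L q (Suc l) c {} D"
    by (auto simp: run_words_def)
qed

lemma run_words_Nil:
  "run_words g L q 0 c A D = (if c = 0 \<and> A = {} \<and> D = {} then {[]} else {})"
  by (auto simp: run_words_def)

lemma leftmost_label:
  assumes "A \<noteq> {}" "A \<subseteq> set (drop q L)"
  obtains p where "q \<le> p" "p < length L" "L ! p \<in> A" "\<And>r. q \<le> r \<Longrightarrow> r < p \<Longrightarrow> L ! r \<notin> A"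
proof -
  let ?P = "\<lambda>p. q \<le> p \<and> p < length L \<and> L ! p \<in> A"
  have "\<exists>p. ?P p"
    using assms by (fastforce simp: in_set_drop_iff)
  then have "?P (LEAST p. ?P p)"
    by (rule LeastI_ex)
  moreover have "L ! r \<notin> A" if "q \<le> r" "r < (LEAST p. ?P p)" for r
    using not_less_Least[OF that(2)] that calculation by auto
  ultimately show ?thesis
    using that by blast
qed

text \<open>Restores the hypothesis of the induction in \<open>card_run_words_eq\<close> after the
  forced letter: everything in \<open>A\<close> can still be reached.\<close>

lemma leftmost_label_subset:
  assumes g: "relabelling g" and L: "distinct L" and A: "A \<subseteq> set (drop q L)"
    and p: "q \<le> p" "p < length L" "\<And>r. q \<le> r \<Longrightarrow> r < p \<Longrightarrow> L ! r \<notin> A"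
  shows "A \<subseteq> set (drop p (g p L))"
proof -
  have "A \<subseteq> set (drop p L)"
    using A p by (auto simp: in_set_drop_iff) (metis linorder_not_less subsetD in_set_drop_iff)
  then show ?thesis
    using relabellingD[OF g L p(2)] by simp
qed

text \<open>Induction on the length. If \<open>A\<close> is nonempty, the forced letters on the two
  sides leave sets of equal size again, either all of \<open>A\<close> or all but one label. If
  \<open>A\<close> is empty, a new run starts at position 0, where both lists offer the same labels,
  so the sums over the next pair of label sets agree term by term.\<close>

lemma card_run_words_eq:
  assumes g: "relabelling g" "relabelling g'"
  shows "\<lbrakk>distinct L; set L = {..<t}; distinct L'; set L' = {..<t}; A \<subseteq> set (drop q L);
    A' \<subseteq> set (drop q' L'); card A = card A'\<rbrakk> \<Longrightarrow>
    card (run_words g L q l c A D) = card (run_words g' L' q' l c A' D)"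
proof (induction l arbitrary: t L L' A A' q q' c D)
  case 0
  have "finite A" "finite A'"
    using "0.prems" by (meson List.finite_set finite_subset)+
  then have "A = {} \<longleftrightarrow> A' = {}"
    using "0.prems" by (metis card_0_eq)
  then show ?case
    by (simp add: run_words_Nil)
next
  case (Suc l)
  have fin: "finite A" "finite A'"
    using Suc.prems by (meson List.finite_set finite_subset)+
  have len: "length L = t" "length L' = t"
    using Suc.prems distinct_card[of L] distinct_card[of L'] by auto
  show ?case
  proof (cases "A = {}")
    case False
    then have "A' \<noteq> {}"
      using Suc.prems fin by (metis card_0_eq)
    obtain p where p: "q \<le> p" "p < length L" "L ! p \<in> A" "\<And>r. q \<le> r \<Longrightarrow> r < p \<Longrightarrow> L ! r \<notin> A"
      using leftmost_label[OF False Suc.prems(5)] by blast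
    obtain p' where p': "q' \<le> p'" "p' < length L'" "L' ! p' \<in> A'"
      "\<And>r. q' \<le> r \<Longrightarrow> r < p' \<Longrightarrow> L' ! r \<notin> A'"
      using leftmost_label[OF \<open>A' \<noteq> {}\<close> Suc.prems(6)] by blast
    have split: "card (run_words h M r (Suc l) c B D) =
        card (run_words h (h s M) s l c B D) + card (run_words h (h s M) s l c (B - {M ! s}) D)"
      if "relabelling h" "distinct M" "r \<le> s" "s < length M" "M ! s \<in> B"
        "\<And>i. r \<le> i \<Longrightarrow> i < s \<Longrightarrow> M ! i \<notin> B" for h M r s B
    proof -
      \<comment> \<open>The two sets are told apart by whether the rest of the run uses the label
        \<open>M ! s\<close> again.\<close>
      have "run_words h (h s M) s l c B D \<inter> run_words h (h s M) s l c (B - {M ! s}) D = {}"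
        using that(5) by (auto simp: run_words_def)
      then show ?thesis
        using run_words_Suc[OF that] by (simp add: card_image card_Un_disjoint finite_run_words)
    qed
    note gL = relabellingD[OF g(1) Suc.prems(1) p(2)] and gL' = relabellingD[OF g(2) Suc.prems(3) p'(2)]
    note sub = leftmost_label_subset[OF g(1) Suc.prems(1,5) p(1,2,4)]
      and sub' = leftmost_label_subset[OF g(2) Suc.prems(3,6) p'(1,2,4)]
    have "card (run_words g (g p L) p l c A D) = card (run_words g' (g' p' L') p' l c A' D)"
      using gL gL' sub sub' Suc.prems by (intro Suc.IH[of _ t]) simp_all
    moreover have "card (run_words g (g p L) p l c (A - {L ! p}) D) =
        card (run_words g' (g' p' L') p' l c (A' - {L' ! p'}) D)"
      using gL gL' sub sub' Suc.prems fin p p' by (intro Suc.IH[of _ t]) auto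
    ultimately show ?thesis
      using split[OF g(1) Suc.prems(1) p] split[OF g(2) Suc.prems(3) p'] by simp
  next
    case True
    then have "A' = {}"
      using Suc.prems fin by (metis card_0_eq)
    show ?thesis
    \<comment> \<open>A word starting with \<open>None\<close> has a positive count of
      \<open>None\<close> and uses finitely many labels, so here both sides are empty. Otherwise the
      pairs with union \<open>D\<close> form a finite index set.\<close>
    proof (cases "c = 0 \<or> infinite D")
      case True
      then have "run_words h M r (Suc l) c B D = {}" if "B = {}" for h M r B
        using that by (auto simp: run_words_Suc_empty) (auto simp: run_words_def finite_later_runs finite_first_run)
      then show ?thesis
        using \<open>A = {}\<close> \<open>A' = {}\<close> by simp
    next
      case False
      define I where "I = {(B, E). B \<union> E = D}"
      have "I \<subseteq> Pow D \<times> Pow D"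
        by (auto simp: I_def)
      then have finI: "finite I"
        using False by (meson finite_Pow_iff finite_SigmaI finite_subset)
      have sum: "card (run_words h M r (Suc l) c {} D) =
          (\<Sum>(B, E)\<in>I. card (run_words h (M @ [length M]) 0 l (c - 1) B E))" for h M r
      proof -
        have "card (run_words h M r (Suc l) c {} D) =
            card (\<Union>(B, E)\<in>I. run_words h (M @ [length M]) 0 l (c - 1) B E)"
          unfolding I_def using False by (simp add: run_words_Suc_empty card_image)
        also have "\<dots> = (\<Sum>i\<in>I. card (case i of (B, E) \<Rightarrow> run_words h (M @ [length M]) 0 l (c - 1) B E))"
          by (rule card_UN_disjoint[OF finI]) (auto simp: finite_run_words, auto simp: run_words_def)
        finally show ?thesis
          unfolding case_prod_unfold .
      qed
      have ext: "distinct (L @ [length L])" "set (L @ [length L]) = {..<Suc t}"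
        "distinct (L' @ [length L'])" "set (L' @ [length L']) = {..<Suc t}"
        using Suc.prems(1-4) len by (simp_all add: lessThan_Suc)
      have "card (run_words g (L @ [length L]) 0 l (c - 1) B E) =
          card (run_words g' (L' @ [length L']) 0 l (c - 1) B E)" for B E
      \<comment> \<open>Labels above \<open>t\<close> do not occur in either list, so any other
        \<open>B\<close> is attained by no word.\<close>
      proof (cases "B \<subseteq> {..<Suc t}")
        case True
        then show ?thesis
          using ext by (intro Suc.IH[of _ "Suc t"]) auto
      next
        case False
        have "run_words g (L @ [length L]) 0 l (c - 1) B E = {}"
          using first_run_subset[OF g(1) ext(1), of 0] False ext(2) unfolding run_words_def by auto
        moreover have "run_words g' (L' @ [length L']) 0 l (c - 1) B E = {}"
          using first_run_subset[OF g(2) ext(3), of 0] False ext(4) unfolding run_words_def by auto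
        ultimately show ?thesis
          by simp
      qed
      then show ?thesis
        using sum \<open>A = {}\<close> \<open>A' = {}\<close> by simp
    qed
  qed
qed

definition hit_labels :: "(nat \<Rightarrow> nat list \<Rightarrow> nat list) \<Rightarrow> nat option list \<Rightarrow> nat set" where
  "hit_labels g ws = first_run g [0] ws \<union> later_runs g [0] ws"

text \<open>The initial slot with label 0 is produced by prepending \<open>None\<close> and starting
  from the empty list. The union in \<open>hit_labels\<close> then becomes the one in
  \<open>run_words_Suc_empty\<close>, and \<open>card_run_words_eq\<close> applies with empty lists
  and empty \<open>A\<close>.\<close>

lemma card_hit_labels_eq:
  assumes "relabelling g" "relabelling g'"
  shows "card {ws. growth_word 1 0 ws \<and> length ws = l \<and> num_runs ws = c \<and> hit_labels g ws = D} =
    card {ws. growth_word 1 0 ws \<and> length ws = l \<and> num_runs ws = c \<and> hit_labels g' ws = D}"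
proof -
  have "card {ws. growth_word 1 0 ws \<and> length ws = l \<and> num_runs ws = c \<and> hit_labels h ws = D} =
      card (run_words h [] 0 (Suc l) (Suc c) {} D)" for h
  proof -
    have "run_words h [] 0 (Suc l) (Suc c) {} D = Cons None `
        {ws. growth_word 1 0 ws \<and> length ws = l \<and> num_runs ws = c \<and> hit_labels h ws = D}"
      by (simp add: run_words_Suc_empty) (auto simp: run_words_def hit_labels_def)
    then show ?thesis
      by (simp add: card_image)
  qed
  then show ?thesis
    using card_run_words_eq[OF assms, of "[]" 0 "[]"] by simp
qed

section \<open>Growth systems\<close>

text \<open>Words speak of positions and growth systems of vertices; counting the smaller slots
  translates between the two.\<close>

lemma sorted_list_of_set_nth:
  fixes A :: "nat set"
  assumes "finite A" "p < card A"
  shows "sorted_list_of_set A ! p \<in> A" "card {b\<in>A. b < sorted_list_of_set A ! p} = p"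
proof -
  let ?xs = "sorted_list_of_set A"
  have len: "length ?xs = card A" and set: "set ?xs = A" and dist: "distinct ?xs" and sort: "sorted ?xs"
    using assms by auto
  show "?xs ! p \<in> A"
    using assms len set nth_mem by metis
  have "{b\<in>A. b < ?xs ! p} = (!) ?xs ` {..<p}"
  proof (intro equalityI subsetI)
    fix b assume b: "b \<in> {b\<in>A. b < ?xs ! p}"
    then obtain i where "i < card A" "b = ?xs ! i"
      using set len by (metis (mono_tags, lifting) in_set_conv_nth mem_Collect_eq)
    moreover have "\<not> p \<le> i"
      using sorted_nth_mono[OF sort, of p i] b calculation len by auto
    ultimately show "b \<in> (!) ?xs ` {..<p}"
      by auto
  next
    fix b assume "b \<in> (!) ?xs ` {..<p}"
    then obtain i where i: "i < p" "b = ?xs ! i"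
      by auto
    then have "?xs ! i \<le> ?xs ! p" "?xs ! i \<noteq> ?xs ! p" "?xs ! i \<in> A"
      using sorted_nth_mono[OF sort, of i p] assms len nth_eq_iff_index_eq[OF dist, of i p] set nth_mem[of i ?xs]
      by auto
    then show "b \<in> {b\<in>A. b < ?xs ! p}"
      using i by auto
  qed
  moreover have "inj_on ((!) ?xs) {..<p}"
    using dist len assms by (intro inj_on_nth) auto
  ultimately show "card {b\<in>A. b < ?xs ! p} = p"
    by (simp add: card_image)
qed

lemma sorted_list_of_set_index:
  fixes A :: "nat set"
  assumes "finite A" "a \<in> A"
  obtains p where "p < card A" "a = sorted_list_of_set A ! p"
  using assms by (metis in_set_conv_nth length_sorted_list_of_set set_sorted_list_of_set)

lemma sorted_list_of_set_append:
  fixes A :: "nat set"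
  assumes "finite A" "\<And>a. a \<in> A \<Longrightarrow> a < b"
  shows "sorted_list_of_set (insert b A) = sorted_list_of_set A @ [b]"
proof -
  let ?xs = "sorted_list_of_set A @ [b]"
  have "sorted ?xs" "distinct ?xs" "set ?xs = insert b A"
    using assms by (auto simp: sorted_append less_imp_le)
  then show ?thesis
    by (metis sorted_list_of_set.idem_if_sorted_distinct)
qed

lemma sorted_list_of_set_image:
  fixes A :: "nat set"
  assumes "finite A" "strict_mono f"
  shows "sorted_list_of_set (f ` A) = map f (sorted_list_of_set A)"
proof (rule sorted_distinct_set_unique)
  show "sorted (map f (sorted_list_of_set A))"
    using assms by (simp add: sorted_map mono_imp_mono_on strict_mono_mono sorted_wrt_mono_rel[of _ "(\<le>)"] monoD)
  show "distinct (map f (sorted_list_of_set A))"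
    using assms by (simp add: distinct_map strict_mono_eq inj_on_def)
qed (use assms in auto)

text \<open>The lower bound for the next \<open>Some\<close> letter. It makes it possible to extend
  words at the right end, as growth does, although \<open>growth_word\<close> recurses from the
  left.\<close>

definition last_position :: "nat \<Rightarrow> nat option list \<Rightarrow> nat" where
  "last_position q ws = foldl (\<lambda>q w. case w of None \<Rightarrow> 0 | Some p \<Rightarrow> p) q ws"

lemma growth_word_snoc:
  "growth_word t q (ws @ [w]) \<longleftrightarrow> growth_word t q ws \<and>
     (case w of None \<Rightarrow> True | Some p \<Rightarrow> last_position q ws \<le> p \<and> p < t + num_runs ws)"
  by (induction t q ws rule: growth_word.induct) (auto simp: last_position_def split: option.splits)

definition final_labels :: "(nat \<Rightarrow> nat list \<Rightarrow> nat list) \<Rightarrow> nat list \<Rightarrow> nat option list \<Rightarrow> nat list" where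
  "final_labels g L ws = foldl (\<lambda>L w. case w of None \<Rightarrow> L @ [length L] | Some p \<Rightarrow> g p L) L ws"

lemma runs_snoc:
  "first_run g L (ws @ [w]) \<union> later_runs g L (ws @ [w]) = first_run g L ws \<union> later_runs g L ws \<union>
     (case w of None \<Rightarrow> {} | Some p \<Rightarrow> {final_labels g L ws ! p})"
  by (induction g L ws rule: later_runs.induct) (auto simp: final_labels_def split: option.splits)

lemma hit_labels_snoc:
  "hit_labels g (ws @ [w]) = hit_labels g ws \<union>
     (case w of None \<Rightarrow> {} | Some p \<Rightarrow> {final_labels g [0] ws ! p})"
  by (simp add: hit_labels_def runs_snoc)

lemma finite_hit_labels: "finite (hit_labels g ws)"
  by (simp add: hit_labels_def finite_first_run finite_later_runs)

lemma final_labels_props: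
  assumes "relabelling g" "growth_word 1 0 ws"
  shows "distinct (final_labels g [0] ws) \<and> set (final_labels g [0] ws) = {..num_runs ws} \<and>
    length (final_labels g [0] ws) = Suc (num_runs ws) \<and> hit_labels g ws \<subseteq> {..num_runs ws}"
  using assms(2)
proof (induction ws rule: rev_induct)
  case Nil
  then show ?case
    by (auto simp: final_labels_def hit_labels_def)
next
  case (snoc w ws)
  then have IH: "distinct (final_labels g [0] ws)" "set (final_labels g [0] ws) = {..num_runs ws}"
      "length (final_labels g [0] ws) = Suc (num_runs ws)" "hit_labels g ws \<subseteq> {..num_runs ws}"
    by (auto simp: growth_word_snoc)
  show ?case
  proof (cases w)
    case None
    then have "final_labels g [0] (ws @ [w]) = final_labels g [0] ws @ [Suc (num_runs ws)]"
      using IH by (simp add: final_labels_def)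
    then show ?thesis
      using IH None by (auto simp: hit_labels_snoc)
  next
    case (Some p)
    then have p: "p < length (final_labels g [0] ws)"
      using snoc.prems IH by (simp add: growth_word_snoc)
    have "final_labels g [0] (ws @ [w]) = g p (final_labels g [0] ws)"
      using Some by (simp add: final_labels_def)
    moreover have "final_labels g [0] ws ! p \<le> num_runs ws"
      using IH(2) nth_mem[OF p] by auto
    ultimately show ?thesis
      using relabellingD[OF assms(1) IH(1) p] IH Some by (auto simp: hit_labels_snoc)
  qed
qed

definition growth_words :: "nat \<Rightarrow> nat option list set" where
  "growth_words l = {ws. growth_word 1 0 ws \<and> length ws = l}"

text \<open>A growth system abstracts structures built step by step: \<open>gr s None\<close> creates a new slot at the
  end, \<open>gr s (Some a)\<close> uses the slot \<open>a\<close>, which must not be \<open>low\<close>. The flag of a slot records whether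
  its label has been used before.\<close>

locale growth_system =
  fixes X :: "nat \<Rightarrow> 's set" and s0 :: 's and slots :: "'s \<Rightarrow> nat set" and low :: "'s \<Rightarrow> nat \<Rightarrow> bool"
    and gr :: "'s \<Rightarrow> nat option \<Rightarrow> 's" and flag :: "'s \<Rightarrow> nat \<Rightarrow> bool" and stat :: "'s \<Rightarrow> nat"
    and sz :: "'s \<Rightarrow> nat" and g :: "nat \<Rightarrow> nat list \<Rightarrow> nat list"
  assumes relab: "relabelling g"
    and X_0: "X 0 = {s0}"
    and start: "card (slots s0) = 1" "b \<in> slots s0 \<Longrightarrow> \<not> low s0 b" "b \<in> slots s0 \<Longrightarrow> \<not> flag s0 b"
      "stat s0 = 0" "sz s0 = 0"
    and finite_slots: "s \<in> X l \<Longrightarrow> finite (slots s)"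
    and low_mono: "low s b \<Longrightarrow> a \<le> b \<Longrightarrow> low s a"
    and cover: "s' \<in> X (Suc l) \<Longrightarrow> (\<exists>s\<in>X l. s' = gr s None) \<or>
      (\<exists>s\<in>X l. \<exists>a\<in>slots s. \<not> low s a \<and> s' = gr s (Some a))"
    and inj_None: "s \<in> X l \<Longrightarrow> s' \<in> X l \<Longrightarrow> gr s None = gr s' None \<Longrightarrow> s = s'"
    and inj_Some: "s \<in> X l \<Longrightarrow> s' \<in> X l \<Longrightarrow> a \<in> slots s \<Longrightarrow> a' \<in> slots s' \<Longrightarrow>
      gr s (Some a) = gr s' (Some a') \<Longrightarrow> s = s' \<and> a = a'"
    and None_Some: "s \<in> X l \<Longrightarrow> s' \<in> X l \<Longrightarrow> a \<in> slots s' \<Longrightarrow> gr s None \<noteq> gr s' (Some a)"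
    and None_props: "s \<in> X l \<Longrightarrow> gr s None \<in> X (Suc l) \<and> card (slots (gr s None)) = Suc (card (slots s)) \<and>
      (\<forall>b\<in>slots (gr s None). \<not> low (gr s None) b) \<and>
      map (flag (gr s None)) (sorted_list_of_set (slots (gr s None))) =
        map (flag s) (sorted_list_of_set (slots s)) @ [False] \<and>
      stat (gr s None) = stat s \<and> sz (gr s None) = sz s"
    and Some_props: "s \<in> X l \<Longrightarrow> a \<in> slots s \<Longrightarrow> \<not> low s a \<Longrightarrow>
      gr s (Some a) \<in> X (Suc l) \<and> card (slots (gr s (Some a))) = card (slots s) \<and>
      card {b\<in>slots (gr s (Some a)). low (gr s (Some a)) b} = card {b\<in>slots s. b < a} \<and>
      stat (gr s (Some a)) = stat s + (if flag s a then 1 else 0) \<and> sz (gr s (Some a)) = Suc (sz s)"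
    and flag_Some: "s \<in> X l \<Longrightarrow> p < card (slots s) \<Longrightarrow> distinct L \<Longrightarrow> length L = card (slots s) \<Longrightarrow>
      map (flag s) (sorted_list_of_set (slots s)) = map (\<lambda>x. x \<in> H) L \<Longrightarrow>
      s' = gr s (Some (sorted_list_of_set (slots s) ! p)) \<Longrightarrow>
      map (flag s') (sorted_list_of_set (slots s')) = map (\<lambda>x. x \<in> insert (L ! p) H) (g p L)"
begin

definition grow :: "nat option list \<Rightarrow> 's" where
  "grow ws = foldl (\<lambda>s w. gr s (map_option ((!) (sorted_list_of_set (slots s))) w)) s0 ws"

lemma grow_simps [simp]:
  "grow [] = s0"
  "grow (ws @ [None]) = gr (grow ws) None"
  "grow (ws @ [Some p]) = gr (grow ws) (Some (sorted_list_of_set (slots (grow ws)) ! p))"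
  by (simp_all add: grow_def)

text \<open>By \<open>low_mono\<close> the low slots are an initial segment of the sorted slots, so
  the admissible positions start at their number.\<close>

lemma low_iff:
  assumes "s \<in> X l" "p < card (slots s)"
  shows "card {b\<in>slots s. low s b} \<le> p \<longleftrightarrow> \<not> low s (sorted_list_of_set (slots s) ! p)"
proof -
  let ?a = "sorted_list_of_set (slots s) ! p"
  have fin: "finite (slots s)"
    using finite_slots[OF assms(1)] .
  note a = sorted_list_of_set_nth[OF fin assms(2)]
  show ?thesis
  proof (cases "low s ?a")
    case True
    have "insert ?a {b\<in>slots s. b < ?a} \<subseteq> {b\<in>slots s. low s b}"
      using True a(1) low_mono[OF True] by auto
    then have "card (insert ?a {b\<in>slots s. b < ?a}) \<le> card {b\<in>slots s. low s b}"
      by (rule card_mono[rotated]) (use fin in simp)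
    then show ?thesis
      using True a fin by simp
  next
    case False
    have "card {b\<in>slots s. low s b} \<le> card {b\<in>slots s. b < ?a}"
    proof (intro card_mono)
      show "{b\<in>slots s. low s b} \<subseteq> {b\<in>slots s. b < ?a}"
      proof
        fix b assume "b \<in> {b\<in>slots s. low s b}"
        then show "b \<in> {b\<in>slots s. b < ?a}"
          using False low_mono[of s b ?a] by (cases "?a \<le> b") auto
      qed
    qed (use fin in auto)
    then show ?thesis
      using False a by simp
  qed
qed

text \<open>Ties a word to the structure it builds. The number of low slots is the bound for the
  next position. Every \<open>Some\<close> letter raises \<open>sz\<close> and exactly one of
  \<open>stat\<close> and the number of hit labels, depending on whether its label was used before;
  the flags, read along the label list, record this.\<close>

lemma grow_props:
  "growth_word 1 0 ws \<Longrightarrow> grow ws \<in> X (length ws) \<and> card (slots (grow ws)) = Suc (num_runs ws) \<and>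
    card {b\<in>slots (grow ws). low (grow ws) b} = last_position 0 ws \<and>
    map (flag (grow ws)) (sorted_list_of_set (slots (grow ws))) =
      map (\<lambda>x. x \<in> hit_labels g ws) (final_labels g [0] ws) \<and>
    stat (grow ws) + card (hit_labels g ws) = sz (grow ws) \<and> sz (grow ws) + num_runs ws = length ws"
proof (induction ws rule: rev_induct)
  case Nil
  obtain b where b: "slots s0 = {b}"
    using start(1) card_1_singletonE by blast
  have "{c. c = b \<and> low s0 c} = {}"
    using start(2) b by auto
  then show ?case
    using b X_0 start(3)[of b] start(4,5) by (simp add: final_labels_def hit_labels_def last_position_def)
next
  case (snoc w ws)
  then have ws: "growth_word 1 0 ws"
    by (simp add: growth_word_snoc)
  note IH = snoc.IH[OF ws] and lab = final_labels_props[OF relab ws]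
  show ?case
  proof (cases w)
    case None
    have "{b\<in>slots (gr (grow ws) None). low (gr (grow ws) None) b} = {}"
      using None_props IH by blast
    then have "card {b\<in>slots (gr (grow ws) None). low (gr (grow ws) None) b} = 0"
      by (simp only: card.empty)
    moreover have "Suc (num_runs ws) \<notin> hit_labels g ws"
      using lab by auto
    ultimately show ?thesis
      using None_props[of "grow ws" "length ws"] IH None lab
      by (simp add: final_labels_def last_position_def hit_labels_snoc)
  next
    case (Some p)
    let ?a = "sorted_list_of_set (slots (grow ws)) ! p"
    have p: "p < card (slots (grow ws))" "last_position 0 ws \<le> p"
      using snoc.prems Some IH by (auto simp: growth_word_snoc)
    have X: "grow ws \<in> X (length ws)" and fin: "finite (slots (grow ws))"
      using IH finite_slots by auto
    have notlow: "\<not> low (grow ws) ?a"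
      using low_iff[OF X p(1)] p(2) IH by simp
    note a = sorted_list_of_set_nth[OF fin p(1)]
    note step = Some_props[OF X a(1) notlow]
    have len: "length (final_labels g [0] ws) = card (slots (grow ws))"
      using lab IH by simp
    have "map (flag (gr (grow ws) (Some ?a))) (sorted_list_of_set (slots (gr (grow ws) (Some ?a)))) =
      map (\<lambda>x. x \<in> insert (final_labels g [0] ws ! p) (hit_labels g ws)) (g p (final_labels g [0] ws))"
      using IH lab len by (intro flag_Some[OF X p(1)]) auto
    moreover have "flag (grow ws) ?a \<longleftrightarrow> final_labels g [0] ws ! p \<in> hit_labels g ws"
    proof -
      have "map (flag (grow ws)) (sorted_list_of_set (slots (grow ws))) ! p =
          map (\<lambda>x. x \<in> hit_labels g ws) (final_labels g [0] ws) ! p"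
        using IH by simp
      then show ?thesis
        using p(1) len by simp
    qed
    moreover have "hit_labels g (ws @ [w]) = insert (final_labels g [0] ws ! p) (hit_labels g ws)"
      using Some by (auto simp: hit_labels_snoc)
    moreover have "final_labels g [0] (ws @ [w]) = g p (final_labels g [0] ws)"
      using Some by (simp add: final_labels_def)
    moreover have "last_position 0 (ws @ [w]) = p"
      using Some by (simp add: last_position_def)
    ultimately show ?thesis
      using step a IH Some by (simp add: card_insert_if finite_hit_labels)
  qed
qed

text \<open>Induction on the length: the two kinds of growth steps are injective with disjoint
  images and cover the next level, so a structure determines its last letter and its predecessor. By
  \<open>low_iff\<close> the admissible letters are exactly the slots that are not low.\<close>

lemma bij_betw_grow: "bij_betw grow (growth_words l) (X l)"
proof (induction l)
  case 0
  have "growth_words 0 = {[]}"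
    by (auto simp: growth_words_def)
  then show ?case
    by (simp add: X_0 bij_betw_def)
next
  case (Suc l)
  have snoc: "\<exists>ws w. us = ws @ [w] \<and> ws \<in> growth_words l \<and> growth_word 1 0 (ws @ [w])"
    if "us \<in> growth_words (Suc l)" for us
    using that by (cases us rule: rev_cases) (auto simp: growth_words_def growth_word_snoc)
  have X: "grow ws \<in> X l" and fin: "finite (slots (grow ws))" if "ws \<in> growth_words l" for ws
    using that grow_props finite_slots by (auto simp: growth_words_def)
  have slot: "p < card (slots (grow ws))" "sorted_list_of_set (slots (grow ws)) ! p \<in> slots (grow ws)"
    if "ws \<in> growth_words l" "growth_word 1 0 (ws @ [Some p])" for ws p
  proof -
    show "p < card (slots (grow ws))"
      using that grow_props[of ws] by (auto simp: growth_words_def growth_word_snoc)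
    then show "sorted_list_of_set (slots (grow ws)) ! p \<in> slots (grow ws)"
      using sorted_list_of_set_nth(1)[OF fin[OF that(1)]] by simp
  qed
  have grow_neq: "grow (ws @ [None]) \<noteq> grow (ws' @ [Some p])"
    if "ws \<in> growth_words l" "ws' \<in> growth_words l" "growth_word 1 0 (ws' @ [Some p])" for ws ws' p
    using None_Some[OF X[OF that(1)] X[OF that(2)] slot(2)[OF that(2,3)]] by simp
  show ?case
    unfolding bij_betw_def
  proof
    show "inj_on grow (growth_words (Suc l))"
    proof (rule inj_onI)
      fix us us' assume us: "us \<in> growth_words (Suc l)" and us': "us' \<in> growth_words (Suc l)" and eq: "grow us = grow us'"
      obtain ws w where ws: "us = ws @ [w]" "ws \<in> growth_words l" "growth_word 1 0 (ws @ [w])"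
        using snoc[OF us] by blast
      obtain ws' w' where ws': "us' = ws' @ [w']" "ws' \<in> growth_words l" "growth_word 1 0 (ws' @ [w'])"
        using snoc[OF us'] by blast
      have "grow ws = grow ws' \<and> w = w'"
      proof (cases w)
        case None
        then have "w' = None"
          using eq ws(1) ws'(1) grow_neq[OF ws(2) ws'(2)] ws'(3) by (cases w') metis+
        then show ?thesis
          using eq ws(1) ws'(1) None inj_None[OF X X, OF ws(2) ws'(2)] by simp
      next
        case (Some p)
        then obtain p' where p': "w' = Some p'"
          using eq ws(1) ws'(1) grow_neq[OF ws'(2) ws(2)] ws(3) by (cases w') metis+
        have s: "p < card (slots (grow ws))" "sorted_list_of_set (slots (grow ws)) ! p \<in> slots (grow ws)"
            "p' < card (slots (grow ws'))" "sorted_list_of_set (slots (grow ws')) ! p' \<in> slots (grow ws')"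
          using slot[of ws p] slot[of ws' p'] ws ws' Some p' by simp_all
        have "gr (grow ws) (Some (sorted_list_of_set (slots (grow ws)) ! p)) =
            gr (grow ws') (Some (sorted_list_of_set (slots (grow ws')) ! p'))"
          using eq ws(1) ws'(1) Some p' by simp
        from inj_Some[OF X[OF ws(2)] X[OF ws'(2)] s(2,4) this]
        have e: "grow ws = grow ws'"
            "sorted_list_of_set (slots (grow ws)) ! p = sorted_list_of_set (slots (grow ws')) ! p'"
          by blast+
        then have "p = p'"
          using s(1,3) by (simp add: nth_eq_iff_index_eq)
        then show ?thesis
          using e Some p' by simp
      qed
      then show "us = us'"
        using Suc.IH ws ws' by (metis bij_betw_def inj_onD)
    qed
    show "grow ` growth_words (Suc l) = X (Suc l)"
    proof (intro equalityI subsetI)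
      fix s assume "s \<in> grow ` growth_words (Suc l)"
      then show "s \<in> X (Suc l)"
        using grow_props unfolding growth_words_def by fastforce
    next
      fix s' assume "s' \<in> X (Suc l)"
      then consider s where "s \<in> X l" "s' = gr s None"
        | s a where "s \<in> X l" "a \<in> slots s" "\<not> low s a" "s' = gr s (Some a)"
        using cover by blast
      then show "s' \<in> grow ` growth_words (Suc l)"
      proof cases
        case 1
        then obtain ws where "ws \<in> growth_words l" "s = grow ws"
          using Suc.IH by (auto simp: bij_betw_def)
        then show ?thesis
          using 1 by (intro image_eqI[of _ _ "ws @ [None]"]) (auto simp: growth_words_def growth_word_snoc)
      next
        case 2
        then obtain ws where ws: "ws \<in> growth_words l" "s = grow ws"
          using Suc.IH by (auto simp: bij_betw_def)
        obtain p where p: "p < card (slots s)" "a = sorted_list_of_set (slots s) ! p"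
          using sorted_list_of_set_index finite_slots 2 by metis
        then have "last_position 0 ws \<le> p"
          using low_iff[OF 2(1) p(1)] 2 ws grow_props[of ws] by (simp add: growth_words_def)
        then show ?thesis
          using 2 ws p grow_props[of ws]
          by (intro image_eqI[of _ _ "ws @ [Some p]"]) (auto simp: growth_words_def growth_word_snoc)
      qed
    qed
  qed
qed

text \<open>The subtractions are exact, since \<open>grow_props\<close> states the underlying
  sums.\<close>

lemma stat_grow:
  assumes "ws \<in> growth_words l"
  shows "stat (grow ws) = l - num_runs ws - card (hit_labels g ws)"
  using grow_props[of ws] assms by (auto simp: growth_words_def)

lemma bij_betw_grow_num_runs:
  assumes "c \<le> l"
  shows "bij_betw grow {ws\<in>growth_words l. num_runs ws = c} {s\<in>X l. sz s = l - c}"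
proof (rule bij_betw_Collect[OF bij_betw_grow])
  fix ws assume "ws \<in> growth_words l"
  then have "sz (grow ws) + num_runs ws = l"
    using grow_props[of ws] by (simp add: growth_words_def)
  then show "sz (grow ws) = l - c \<longleftrightarrow> num_runs ws = c"
    using assms by linarith
qed

end

section \<open>Growing partitions without right nestings\<close>

text \<open>Arcs ending at consecutive vertices start in the same order. The reverse order is a
  right nesting, and equal starting points cannot occur in a diagram.\<close>

definition no_right_nesting :: "(nat \<times> nat) set \<Rightarrow> bool" where
  "no_right_nesting E \<longleftrightarrow> (\<forall>i i' j. (i', j) \<in> E \<longrightarrow> (i, Suc j) \<in> E \<longrightarrow> i' < i)"

text \<open>Shared by both systems, with the same effect on positions for different reasons. After a
  use of \<open>a\<close> the slots below \<open>a\<close> are low; in a matching the slot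
  \<open>a\<close> survives as \<open>a + 1\<close>, while in a partition it disappears and its
  position passes to the next slot.\<close>

definition is_low :: "(nat \<times> nat) set \<times> nat \<Rightarrow> nat \<Rightarrow> bool" where
  "is_low = (\<lambda>(E, m) b. \<exists>i. (i, m) \<in> E \<and> b \<le> i)"

text \<open>Attaching the next vertex to a block replaces the slot of the block by that vertex. It
  is the largest one, so the label of the block goes last.\<close>

definition move_to_end :: "nat \<Rightarrow> nat list \<Rightarrow> nat list" where
  "move_to_end p L = take p L @ drop (Suc p) L @ [L ! p]"

lemma relabelling_move_to_end: "relabelling move_to_end"
  unfolding relabelling_def
proof (intro allI impI)
  fix p :: nat and L :: "nat list"
  assume L: "distinct L" "p < length L"
  have split: "L = take p L @ L ! p # drop (Suc p) L"
    using L by (simp add: id_take_nth_drop)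
  have "distinct (take p L @ L ! p # drop (Suc p) L)"
    using L(1) split by simp
  then have "distinct (move_to_end p L)"
    by (auto simp: move_to_end_def)
  moreover have "set (take p L @ L ! p # drop (Suc p) L) = set L"
    using split by simp
  then have "set (move_to_end p L) = set L"
    by (auto simp: move_to_end_def)
  moreover have "drop p L = L ! p # drop (Suc p) L"
    using L by (simp add: Cons_nth_drop_Suc)
  then have "set (drop p (move_to_end p L)) = set (drop p L)"
    using L(2) by (auto simp: move_to_end_def)
  moreover have "length (move_to_end p L) = length L"
    using L(2) by (simp add: move_to_end_def)
  ultimately show "distinct (move_to_end p L) \<and> length (move_to_end p L) = length L \<and>
      set (move_to_end p L) = set L \<and> set (drop p (move_to_end p L)) = set (drop p L)"
    by blast
qed

lemma sorted_list_of_set_delete_nth: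
  fixes A :: "nat set"
  assumes "finite A" "p < card A"
  shows "sorted_list_of_set (A - {sorted_list_of_set A ! p}) =
    take p (sorted_list_of_set A) @ drop (Suc p) (sorted_list_of_set A)"
proof -
  let ?xs = "sorted_list_of_set A" and ?ys = "take p (sorted_list_of_set A) @ drop (Suc p) (sorted_list_of_set A)"
  have split: "?xs = take p ?xs @ ?xs ! p # drop (Suc p) ?xs"
    using assms by (simp add: id_take_nth_drop)
  have "sorted (take p ?xs @ ?xs ! p # drop (Suc p) ?xs)" "distinct (take p ?xs @ ?xs ! p # drop (Suc p) ?xs)"
      "set (take p ?xs @ ?xs ! p # drop (Suc p) ?xs) = A"
    using split assms by simp_all
  then have "sorted ?ys" "distinct ?ys" "set ?ys = A - {?xs ! p}"
    by (auto simp: sorted_append)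
  then show ?thesis
    by (metis sorted_list_of_set.idem_if_sorted_distinct)
qed

text \<open>Vertex 1 is present before the first letter and is the initial slot. So \<open>l\<close>
  letters give \<open>l + 1\<close> vertices, the source of the \<open>+ 1\<close> in the
  theorem.\<close>

definition partition_states :: "nat \<Rightarrow> ((nat \<times> nat) set \<times> nat) set" where
  "partition_states l = {(E, m). m = Suc l \<and> arc_diagram m E \<and> no_right_nesting E}"

text \<open>The block maxima, singletons included.\<close>

definition partition_slots :: "(nat \<times> nat) set \<times> nat \<Rightarrow> nat set" where
  "partition_slots = (\<lambda>(E, m). {1..m} - Domain E)"

definition partition_gr :: "(nat \<times> nat) set \<times> nat \<Rightarrow> nat option \<Rightarrow> (nat \<times> nat) set \<times> nat" where
  "partition_gr = (\<lambda>(E, m) w. case w of None \<Rightarrow> (E, Suc m) | Some a \<Rightarrow> (insert (a, Suc m) E, Suc m))"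

section \<open>Adding and removing the last vertex of a diagram\<close>

lemma diagram_vertices: 
  assumes "arc_diagram m E"
  shows "x \<in> Domain E \<Longrightarrow> 1 \<le> x \<and> x < m" "x \<in> Range E \<Longrightarrow> 1 < x \<and> x \<le> m"
  using arc_diagramD[OF assms] by fastforce+

lemma arc_diagram_mono: "arc_diagram m E \<Longrightarrow> m \<le> m' \<Longrightarrow> arc_diagram m' E"
  by (fastforce simp: arc_diagram_def)

lemma arc_diagram_shrink: "arc_diagram (Suc m) E \<Longrightarrow> Suc m \<notin> Range E \<Longrightarrow> arc_diagram m E"
  by (fastforce simp: arc_diagram_def le_Suc_eq)

lemma arc_diagram_insert:
  assumes "arc_diagram m E" "a \<in> {1..m} - Domain E"
  shows "arc_diagram (Suc m) (insert (a, Suc m) E)"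
  using assms diagram_vertices[OF assms(1)] unfolding arc_diagram_def single_valued_def by fastforce

lemma arc_diagram_remove:
  assumes "arc_diagram (Suc m) E" "(a, Suc m) \<in> E"
  shows "arc_diagram m (E - {(a, Suc m)})" "a \<in> {1..m} - Domain (E - {(a, Suc m)})"
proof -
  have "arc_diagram (Suc m) (E - {(a, Suc m)})"
    using assms(1) by (auto simp: arc_diagram_def single_valued_def)
  moreover have "Suc m \<notin> Range (E - {(a, Suc m)})"
    using arc_diagram_left_unique[OF assms(1) assms(2)] by auto
  ultimately show "arc_diagram m (E - {(a, Suc m)})"
    by (rule arc_diagram_shrink)
  show "a \<in> {1..m} - Domain (E - {(a, Suc m)})"
    using arc_diagram_right_unique[OF assms] arc_diagramD[OF assms] by auto
qed

lemma arc_diagram_empty: "arc_diagram m {}"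
  by (simp add: arc_diagram_def)

text \<open>A block maximum is flagged when its block already has an arc; attaching the next vertex
  to it then creates a transient. The goals follow the order of the assumptions of the locale, with
  five goals from \<open>start\<close>.\<close>

interpretation partition: growth_system partition_states "({}, 1)" partition_slots is_low partition_gr
  "\<lambda>(E, m) b. b \<in> Range E" "\<lambda>(E, m). card (Domain E \<inter> Range E)" "\<lambda>(E, m). card E" move_to_end
proof (unfold_locales, goal_cases)
  case 1
  then show ?case by (rule relabelling_move_to_end)
next
  case 2
  have "E = {}" if "arc_diagram (Suc 0) E" for E
    using arc_diagramD[OF that] by (metis One_nat_def equals0I less_le_trans not_less surj_pair)
  then show ?case
    by (auto simp: partition_states_def arc_diagram_empty no_right_nesting_def)
next
  case 3
  then show ?case by (simp add: partition_slots_def)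
next
  case (4 b)
  then show ?case by (simp add: is_low_def)
next
  case (5 b)
  then show ?case by simp
next
  case 6
  then show ?case by simp
next
  case 7
  then show ?case by simp
next
  case (8 s l)
  then show ?case by (cases s) (simp add: partition_slots_def)
next
  case (9 s b a)
  then show ?case by (auto simp: is_low_def)
next
  case (10 s' l)
  define m where "m = Suc l"
  obtain E where E: "s' = (E, Suc m)" "arc_diagram (Suc m) E" "no_right_nesting E"
    using 10 by (auto simp: partition_states_def m_def)
  show ?case
  proof (cases "Suc m \<in> Range E")
    case False
    then have "(E, m) \<in> partition_states l" "s' = partition_gr (E, m) None"
      using E arc_diagram_shrink by (auto simp: partition_states_def m_def partition_gr_def)
    then show ?thesis
      by blast
  next
    case True
    then obtain a where a: "(a, Suc m) \<in> E"
      by auto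
    define F where "F = E - {(a, Suc m)}"
    have "(F, m) \<in> partition_states l"
      using E a arc_diagram_remove[OF E(2) a]
      by (auto simp: partition_states_def m_def F_def no_right_nesting_def)
    moreover have "a \<in> partition_slots (F, m)"
      using arc_diagram_remove[OF E(2) a] by (simp add: F_def partition_slots_def)
    moreover have "\<not> is_low (F, m) a"
    proof
      assume "is_low (F, m) a"
      then obtain i where i: "(i, m) \<in> E" "a \<le> i"
        by (auto simp: is_low_def F_def)
      then have "i < a"
        using E(3) a unfolding no_right_nesting_def by blast
      with i(2) show False
        by simp
    qed
    moreover have "s' = partition_gr (F, m) (Some a)"
      using E a by (auto simp: F_def partition_gr_def)
    ultimately show ?thesis
      by blast
  qed
next
  case (11 s l s')
  then show ?case by (cases s; cases s') (simp add: partition_gr_def)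
next
  case (12 s l s' a a')
  obtain E F m where s: "s = (E, m)" "s' = (F, m)" "arc_diagram m E" "arc_diagram m F"
    using 12 by (auto simp: partition_states_def)
  have eq: "insert (a, Suc m) E = insert (a', Suc m) F"
    using 12(5) s by (simp add: partition_gr_def)
  have no: "(x, Suc m) \<notin> E" "(x, Suc m) \<notin> F" for x
    using arc_diagramD(3)[OF s(3)] arc_diagramD(3)[OF s(4)] by fastforce+
  have "(a, Suc m) \<in> insert (a', Suc m) F"
    using eq[symmetric] by simp
  then have "a = a'"
    using no by auto
  moreover have "E = F"
    using eq no \<open>a = a'\<close> by (metis insert_ident)
  ultimately show ?case
    using s by simp
next
  case (13 s l s' a)
  obtain E F m where s: "s = (E, m)" "s' = (F, m)" "arc_diagram m E"
    using 13 by (auto simp: partition_states_def)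
  have "(a, Suc m) \<notin> E"
    using arc_diagramD(3)[OF s(3)] by fastforce
  then show ?case
    using s by (auto simp: partition_gr_def)
next
  case (14 s l)
  obtain E m where s: "s = (E, m)" "m = Suc l" "arc_diagram m E" "no_right_nesting E"
    using 14 by (auto simp: partition_states_def)
  have v: "Suc m \<notin> Domain E" "Suc m \<notin> Range E"
    using diagram_vertices[OF s(3)] by fastforce+
  then have sl: "partition_slots (E, Suc m) = insert (Suc m) (partition_slots (E, m))"
    by (auto simp: partition_slots_def)
  have "sorted_list_of_set (insert (Suc m) (partition_slots (E, m))) =
      sorted_list_of_set (partition_slots (E, m)) @ [Suc m]"
    by (rule sorted_list_of_set_append) (auto simp: partition_slots_def)
  moreover have "Suc m \<notin> partition_slots (E, m)" "finite (partition_slots (E, m))"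
    by (auto simp: partition_slots_def)
  moreover have "(E, Suc m) \<in> partition_states (Suc l)"
    using s arc_diagram_mono[OF s(3)] by (simp add: partition_states_def)
  moreover have "\<not> is_low (E, Suc m) b" for b
    using v by (auto simp: is_low_def)
  moreover have "partition_gr (E, m) None = (E, Suc m)"
    by (simp add: partition_gr_def)
  ultimately show ?case
    using s(1) v by (simp only: sl) (simp add: Range_iff)
next
  case (15 s l a)
  obtain E m where s: "s = (E, m)" "m = Suc l" "arc_diagram m E" "no_right_nesting E"
    using 15 by (auto simp: partition_states_def)
  define F where "F = insert (a, Suc m) E"
  have a: "a \<in> {1..m} - Domain E"
    using 15 s by (simp add: partition_slots_def)
  have v: "Suc m \<notin> Domain E" "Suc m \<notin> Range E"
    using diagram_vertices[OF s(3)] by fastforce+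
  have sl: "partition_slots (F, Suc m) = insert (Suc m) (partition_slots (E, m) - {a})"
    using a v by (auto simp: partition_slots_def F_def)
  have gr: "partition_gr (E, m) (Some a) = (F, Suc m)"
    by (simp add: partition_gr_def F_def)
  have F: "arc_diagram (Suc m) F"
    using arc_diagram_insert[OF s(3) a] by (simp add: F_def)
  have "i' < i" if "(i', j) \<in> F" "(i, Suc j) \<in> F" for i i' j
  \<comment> \<open>No arc ends beyond \<open>Suc m\<close>, so the new arc can form a right nesting
    only with an arc ending at \<open>m\<close>. That \<open>a\<close> is not low excludes
    this.\<close>
  proof (cases "j = m")
    case True
    then have "(i', m) \<in> E" "i = a"
      using that v by (auto simp: F_def)
    then show ?thesis
      using 15(3) s(1) by (auto simp: is_low_def)
  next
    case False
    then have "(i, Suc j) \<in> E" "j \<noteq> Suc m"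
      using that arc_diagramD(3)[OF F that(2)] by (auto simp: F_def)
    then show ?thesis
      using that s(4) by (auto simp: F_def no_right_nesting_def)
  qed
  then have "(F, Suc m) \<in> partition_states (Suc l)"
    using F s by (simp add: partition_states_def no_right_nesting_def)
  moreover have "card (partition_slots (F, Suc m)) = card (partition_slots (E, m))"
  proof -
    have "finite (partition_slots (E, m))" "a \<in> partition_slots (E, m)"
        "Suc m \<notin> partition_slots (E, m) - {a}"
      using a by (auto simp: partition_slots_def)
    then show ?thesis
      unfolding sl by (metis card_Suc_Diff1 card_insert_disjoint finite_Diff)
  qed
  \<comment> \<open>The only arc into \<open>Suc m\<close> starts at \<open>a\<close>, and
    \<open>a\<close> itself is no longer a slot.\<close>
  moreover have "{b\<in>partition_slots (F, Suc m). is_low (F, Suc m) b} = {b\<in>partition_slots (E, m). b < a}"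
    unfolding sl using a v by (auto simp: is_low_def F_def)
  moreover have "card (Domain F \<inter> Range F) = card (Domain E \<inter> Range E) + (if a \<in> Range E then 1 else 0)"
  proof -
    have "Domain F \<inter> Range F = (if a \<in> Range E then insert a (Domain E \<inter> Range E) else Domain E \<inter> Range E)"
      using a v by (auto simp: F_def)
    then show ?thesis
      using a arc_diagram_finite[OF s(3)] by (auto simp: finite_Domain)
  qed
  moreover have "card F = Suc (card E)"
    using v arc_diagram_finite[OF s(3)] by (auto simp: F_def Range_iff)
  ultimately show ?case
    using s(1) gr by simp
next
  case (16 s l p L H s')
  obtain E m where s: "s = (E, m)" "m = Suc l" "arc_diagram m E"
    using 16 by (auto simp: partition_states_def)
  let ?xs = "sorted_list_of_set (partition_slots (E, m))"
  define a where "a = ?xs ! p"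
  define F where "F = insert (a, Suc m) E"
  have fin: "finite (partition_slots (E, m))"
    by (auto simp: partition_slots_def)
  have p: "p < card (partition_slots (E, m))"
    using 16 s by simp
  have a: "a \<in> {1..m} - Domain E"
    using sorted_list_of_set_nth(1)[OF fin p] by (simp add: a_def partition_slots_def)
  have v: "Suc m \<notin> Domain E" "Suc m \<notin> Range E"
    using diagram_vertices[OF s(3)] by fastforce+
  have sl: "partition_slots (F, Suc m) = insert (Suc m) (partition_slots (E, m) - {a})"
    using a v by (auto simp: partition_slots_def F_def)
  have "sorted_list_of_set (partition_slots (F, Suc m)) = sorted_list_of_set (partition_slots (E, m) - {a}) @ [Suc m]"
    unfolding sl by (rule sorted_list_of_set_append) (auto simp: partition_slots_def)
  also have "\<dots> = take p ?xs @ drop (Suc p) ?xs @ [Suc m]"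
    using sorted_list_of_set_delete_nth[OF fin p] by (simp add: a_def)
  finally have sorted: "sorted_list_of_set (partition_slots (F, Suc m)) = take p ?xs @ drop (Suc p) ?xs @ [Suc m]" .
  have flags: "map (\<lambda>b. b \<in> Range E) ?xs = map (\<lambda>x. x \<in> H) L"
    using 16 s by simp
  \<comment> \<open>The remaining slots keep their flags, as \<open>Range\<close> gains only
    \<open>Suc m\<close>; the remaining labels keep theirs, as \<open>L\<close> is distinct and so
    \<open>L ! p\<close> is not among them.\<close>
  have "map (\<lambda>b. b \<in> Range F) (take p ?xs @ drop (Suc p) ?xs) = map (\<lambda>b. b \<in> Range E) (take p ?xs @ drop (Suc p) ?xs)"
  proof (rule map_cong[OF refl])
    fix b assume "b \<in> set (take p ?xs @ drop (Suc p) ?xs)"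
    then have "b \<in> partition_slots (E, m)"
      using fin by (auto dest: in_set_takeD in_set_dropD)
    then show "b \<in> Range F \<longleftrightarrow> b \<in> Range E"
      by (auto simp: partition_slots_def F_def)
  qed
  also have "\<dots> = take p (map (\<lambda>b. b \<in> Range E) ?xs) @ drop (Suc p) (map (\<lambda>b. b \<in> Range E) ?xs)"
    by (simp add: take_map drop_map)
  also have "\<dots> = map (\<lambda>x. x \<in> H) (take p L @ drop (Suc p) L)"
    unfolding flags by (simp add: take_map drop_map)
  also have "\<dots> = map (\<lambda>x. x \<in> insert (L ! p) H) (take p L @ drop (Suc p) L)"
  proof (rule map_cong[OF refl])
    have "p < length L"
      using p 16(4) s(1) by simp
    then have "distinct (take p L @ L ! p # drop (Suc p) L)"
      using 16(3) id_take_nth_drop[of p L] by metis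
    moreover fix x assume "x \<in> set (take p L @ drop (Suc p) L)"
    ultimately show "x \<in> H \<longleftrightarrow> x \<in> insert (L ! p) H"
      by auto
  qed
  finally have "map (\<lambda>b. b \<in> Range F) (sorted_list_of_set (partition_slots (F, Suc m))) =
      map (\<lambda>x. x \<in> insert (L ! p) H) (move_to_end p L)"
    unfolding sorted by (simp add: move_to_end_def F_def)
  moreover have "s' = (F, Suc m)"
    using 16(6) s(1) by (simp add: partition_gr_def F_def a_def)
  ultimately show ?case
    by simp
qed

section \<open>Inserting an arc into a matching\<close>

text \<open>In order: no transients, no neighbor alignments, no left nestings, no right nestings.
  Each condition concerns a vertex or two consecutive vertices, so inserting a vertex can disturb
  only its neighbourhood.\<close>

definition matching_diagram :: "nat \<Rightarrow> (nat \<times> nat) set \<Rightarrow> bool" where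
  "matching_diagram n E \<longleftrightarrow> arc_diagram n E \<and> Domain E \<inter> Range E = {} \<and>
     (\<forall>j\<in>Range E. Suc j \<notin> Domain E) \<and> (\<forall>i j j'. (i, j) \<in> E \<longrightarrow> (Suc i, j') \<in> E \<longrightarrow> j < j') \<and>
     no_right_nesting E"

definition shift :: "nat \<Rightarrow> nat \<Rightarrow> nat" where
  "shift a v = (if v < a then v else Suc v)"

text \<open>Inserting the opener at \<open>a\<close> already moves the last vertex to
  \<open>n + 1\<close>, so the appended closer is \<open>n + 2\<close>.\<close>

definition insert_arc :: "nat \<Rightarrow> nat \<Rightarrow> (nat \<times> nat) set \<Rightarrow> (nat \<times> nat) set" where
  "insert_arc a n E = insert (a, Suc (Suc n)) (map_prod (shift a) (shift a) ` E)"

lemma shift_simps [simp]: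
  "shift a u = shift a v \<longleftrightarrow> u = v" "shift a u < shift a v \<longleftrightarrow> u < v" "shift a u \<noteq> a" "a \<noteq> shift a u"
  "shift a v \<in> shift a ` A \<longleftrightarrow> v \<in> A" "a \<notin> shift a ` A" "shift a v < a \<longleftrightarrow> v < a"
  by (auto simp: shift_def)

text \<open>The insertion separates only the consecutive vertices \<open>a - 1\<close> and
  \<open>a\<close>. Away from this gap, conditions on consecutive vertices are the same before and
  after it.\<close>

lemma Suc_shift_eq: "Suc (shift a u) = shift a v \<longleftrightarrow> v = Suc u \<and> v \<noteq> a"
  by (auto simp: shift_def)

lemma Suc_cut_eq_shift: "Suc a = shift a u \<longleftrightarrow> u = a"
  by (auto simp: shift_def)

lemma shift_surj: "x \<noteq> a \<Longrightarrow> \<exists>v. x = shift a v"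
  by (rule exI[of _ "if x < a then x else x - 1"]) (auto simp: shift_def)

lemma shift_strict_mono: "strict_mono (shift a)"
  by (simp add: strict_mono_def)

lemma in_insert_arc:
  "(x, y) \<in> insert_arc a n E \<longleftrightarrow>
     x = a \<and> y = Suc (Suc n) \<or> (\<exists>u v. (u, v) \<in> E \<and> x = shift a u \<and> y = shift a v)"
  by (auto simp: insert_arc_def image_iff Bex_def)

lemma insert_arc_Domain: "Domain (insert_arc a n E) = insert a (shift a ` Domain E)"
  by (simp add: insert_arc_def Domain_fst image_image)

lemma insert_arc_Range: "Range (insert_arc a n E) = insert (Suc (Suc n)) (shift a ` Range E)"
  by (simp add: insert_arc_def Range_snd image_image)

text \<open>The slots are the positions at which an inserted opener ends a possibly empty run of openers
  that follows a singleton or the beginning: inserted elsewhere, it would create a neighbor alignment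
  or a left nesting.\<close>

definition matching_slots :: "(nat \<times> nat) set \<times> nat \<Rightarrow> nat set" where
  "matching_slots = (\<lambda>(E, n). {b\<in>{1..Suc n}. b - 1 \<notin> Range E \<and> b \<notin> Domain E})"

definition matching_gr :: "(nat \<times> nat) set \<times> nat \<Rightarrow> nat option \<Rightarrow> (nat \<times> nat) set \<times> nat" where
  "matching_gr = (\<lambda>(E, n) w. case w of None \<Rightarrow> (E, Suc n) | Some a \<Rightarrow> (insert_arc a n E, Suc (Suc n)))"

text \<open>An arc takes one letter but contributes two vertices.\<close>

definition matching_states :: "nat \<Rightarrow> ((nat \<times> nat) set \<times> nat) set" where
  "matching_states l = {(E, n). n = l + card E \<and> matching_diagram n E}"

text \<open>In the matchings considered these vertices correspond to the left crossings; see
  \<open>num_left_crossings_eq\<close>.\<close>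

definition opener_pairs :: "(nat \<times> nat) set \<Rightarrow> nat set" where
  "opener_pairs E = {i. i \<in> Domain E \<and> Suc i \<in> Domain E}"

lemma matching_diagramD:
  assumes "matching_diagram n E"
  shows "arc_diagram n E" "x \<in> Domain E \<Longrightarrow> x \<notin> Range E" "j \<in> Range E \<Longrightarrow> Suc j \<notin> Domain E"
    "(i, j) \<in> E \<Longrightarrow> (Suc i, j') \<in> E \<Longrightarrow> j < j'" "(i', j) \<in> E \<Longrightarrow> (i, Suc j) \<in> E \<Longrightarrow> i' < i"
  using assms by (auto simp: matching_diagram_def no_right_nesting_def)

text \<open>Since \<open>a\<close> is a slot, the new opener neither follows a closer nor precedes
  an opener. If the old last vertex is a closer, its opener lies before \<open>a\<close>, since
  \<open>a\<close> is not low.\<close>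

lemma matching_diagram_insert_arc:
  assumes E: "matching_diagram n E" and a: "a \<in> matching_slots (E, n)" "\<not> is_low (E, n) a"
  shows "matching_diagram (Suc (Suc n)) (insert_arc a n E)"
proof -
  let ?F = "insert_arc a n E" and ?N = "Suc (Suc n)"
  note D = matching_diagramD[OF E]
  have bd: "1 \<le> i" "i < j" "j \<le> n" if "(i, j) \<in> E" for i j
    using arc_diagramD[OF D(1) that] by auto
  have a': "1 \<le> a" "a \<le> Suc n" "a - 1 \<notin> Range E" "a \<notin> Domain E"
    using a(1) by (auto simp: matching_slots_def)
  have sh: "1 \<le> shift a i" "shift a i < shift a j" "shift a j \<le> Suc n" "shift a i \<le> n" if "(i, j) \<in> E" for i j
    using bd[OF that] by (auto simp: shift_def)
  have noN: "shift a v \<noteq> ?N" if "v \<in> Domain E \<union> Range E" for v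
  proof -
    have "v \<le> n"
      using that diagram_vertices[OF D(1), of v] by (metis UnE less_imp_le)
    then show ?thesis
      by (simp add: shift_def)
  qed
  have noN': "shift a v = ?N \<Longrightarrow> (u, v) \<notin> E" "?N = shift a v \<Longrightarrow> (u, v) \<notin> E" for u v
    using noN[of v] by auto
  have arc: "arc_diagram ?N ?F"
    unfolding arc_diagram_def
  proof (intro conjI)
    have "1 \<le> i \<and> i < j \<and> j \<le> ?N" if "(i, j) \<in> ?F" for i j
      using that[unfolded in_insert_arc]
    proof (elim disjE exE conjE)
      fix u v assume "(u, v) \<in> E" "i = shift a u" "j = shift a v"
      then show ?thesis
        using sh[of u v] by simp
    qed (use a' in simp)
    then show "\<forall>(i, j)\<in>?F. 1 \<le> i \<and> i < j \<and> j \<le> ?N"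
      by blast
    show "single_valued ?F"
      using arc_diagram_right_unique[OF D(1)] by (auto simp: in_insert_arc single_valued_def)
    show "single_valued (?F\<inverse>)"
      using arc_diagram_left_unique[OF D(1)] noN'
      by (auto simp: in_insert_arc single_valued_def)
  qed
  moreover have "Domain ?F \<inter> Range ?F = {}"
  proof -
    have "?N \<notin> shift a ` Domain E"
      using noN by (metis UnI1 imageE)
    moreover have "shift a ` Domain E \<inter> shift a ` Range E = {}"
    proof -
      have "inj (shift a)"
        by (simp add: inj_on_def)
      then have "shift a ` Domain E \<inter> shift a ` Range E = shift a ` (Domain E \<inter> Range E)"
        by (rule image_Int[symmetric])
      also have "Domain E \<inter> Range E = {}"
        using E by (simp add: matching_diagram_def)
      finally show ?thesis
        by simp
    qed
    ultimately show ?thesis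
      unfolding insert_arc_Domain insert_arc_Range using a'(2) by simp
  qed
  moreover have "Suc j \<notin> Domain ?F" if "j \<in> Range ?F" for j
  proof (cases "j = ?N")
    case True
    show ?thesis
    proof
      assume "Suc j \<in> Domain ?F"
      from diagram_vertices(1)[OF arc this] True show False
        by simp
    qed
  next
    case False
    then obtain v where v: "v \<in> Range E" "j = shift a v"
      using \<open>j \<in> Range ?F\<close> unfolding insert_arc_Range by blast
    have "Suc v \<noteq> a"
      using a'(3) v(1) by auto
    then have "Suc j = shift a (Suc v)"
      using v(2) Suc_shift_eq[of a v "Suc v"] by simp
    then show ?thesis
      using D(3)[OF v(1)] by (simp add: insert_arc_Domain del: Domain_iff)
  qed
  moreover have "j < j'" if ij: "(i, j) \<in> ?F" "(Suc i, j') \<in> ?F" for i j j'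
  \<comment> \<open>The second opener is the new one, and its closer is the largest vertex.\<close>
  proof (cases "Suc i = a")
    case True
    then have "j' = ?N" "(i, j) \<noteq> (a, ?N)"
      using ij by (auto simp: in_insert_arc)
    then show ?thesis
      using ij sh by (fastforce simp: in_insert_arc)
  next
    case False
    then obtain u' v' where u': "(u', v') \<in> E" "Suc i = shift a u'" "j' = shift a v'"
      using ij(2) by (auto simp: in_insert_arc)
    then have "i \<noteq> a"
      using a'(4) by (auto simp: Suc_cut_eq_shift)
    then obtain u v where "(u, v) \<in> E" "i = shift a u" "j = shift a v"
      using ij(1) by (auto simp: in_insert_arc)
    then show ?thesis
      using u' D(4) by (auto simp: Suc_shift_eq)
  qed
  moreover have "i' < i" if ij: "(i', j) \<in> ?F" "(i, Suc j) \<in> ?F" for i i' j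
  proof -
    have "j \<noteq> ?N"
      using arc_diagramD(3)[OF arc ij(2)] by auto
    then obtain u v where u: "(u, v) \<in> E" "i' = shift a u" "j = shift a v"
      using ij(1) by (auto simp: in_insert_arc)
    show ?thesis
    proof (cases "Suc j = ?N")
      case True
      then have "i = a"
        using ij(2) noN' True by (auto simp: in_insert_arc)
      \<comment> \<open>The closer before \<open>?N\<close> is \<open>Suc n\<close>, the shifted
        vertex \<open>n\<close>. Had the opener been inserted behind \<open>n\<close>, then
        \<open>Suc n\<close> would be \<open>a\<close>, which is not a value of
        \<open>shift a\<close>.\<close>
      have "v = n" "n < a \<Longrightarrow> False"
        using True u bd[OF u(1)] a' by (auto simp: shift_def split: if_splits)
      then have "u < a"
        using a(2) u by (auto simp: is_low_def)
      then show ?thesis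
        using u \<open>i = a\<close> by simp
    next
      case False
      then obtain u' v' where "(u', v') \<in> E" "i = shift a u'" "Suc j = shift a v'"
        using ij(2) by (auto simp: in_insert_arc)
      then show ?thesis
        using u D(5) by (auto simp: Suc_shift_eq)
    qed
  qed
  ultimately show ?thesis
    by (auto simp: matching_diagram_def no_right_nesting_def)
qed

text \<open>Admissibility of \<open>a\<close> can be read off from \<open>F\<close>, because
  \<open>(a, N)\<close> closes last: a closer at \<open>a - 1\<close> would give a neighbor
  alignment, an opener at \<open>a + 1\<close> a left nesting, and a low \<open>a\<close> a right
  nesting with the arc ending at \<open>N - 1\<close>.\<close>

lemma matching_diagram_remove_arc:
  assumes F: "matching_diagram N F" and a: "(a, N) \<in> F"
  obtains E n where "N = Suc (Suc n)" "F = insert_arc a n E" "matching_diagram n E"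
    "a \<in> matching_slots (E, n)" "\<not> is_low (E, n) a"
proof -
  note D = matching_diagramD[OF F]
  have bd: "1 \<le> i" "i < j" "j \<le> N" if "(i, j) \<in> F" for i j
    using arc_diagramD[OF D(1) that] by auto
  define n where "n = N - 2"
  have N: "N = Suc (Suc n)"
    using bd[OF a] by (simp add: n_def)
  define E where "E = {(u, v). (shift a u, shift a v) \<in> F \<and> shift a v \<noteq> N}"
  have F_eq: "F = insert_arc a n E"
  proof -
    have "(x, y) \<in> F \<longleftrightarrow> (x, y) \<in> insert_arc a n E" for x y
    proof
      assume xy: "(x, y) \<in> F"
      show "(x, y) \<in> insert_arc a n E"
      proof (cases "y = N")
        case True
        then show ?thesis
          using arc_diagram_left_unique[OF D(1) a] xy N by (auto simp: in_insert_arc)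
      next
        case False
        \<comment> \<open>An arc other than \<open>(a, N)\<close> avoids \<open>a\<close>: this
          vertex opens only one arc and, in a matching, closes none.\<close>
        then have "x \<noteq> a" "y \<noteq> a"
          using arc_diagram_right_unique[OF D(1) a] xy D(2)[of a] a by blast+
        then obtain u v where "x = shift a u" "y = shift a v"
          using shift_surj by metis
        then show ?thesis
          using xy False by (auto simp: in_insert_arc E_def)
      qed
    next
      assume "(x, y) \<in> insert_arc a n E"
      then show "(x, y) \<in> F"
        using a N by (auto simp: in_insert_arc E_def)
    qed
    then show ?thesis
      by auto
  qed
  have aN: "1 \<le> a" "a \<le> Suc n"
    using bd[OF a] N by auto
  have bdE: "1 \<le> u" "u < v" "v \<le> n" if "(u, v) \<in> E" for u v
  proof -
    have uv: "(shift a u, shift a v) \<in> F" "shift a v \<noteq> N"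
      using that by (auto simp: E_def)
    show "u < v"
      using bd(2)[OF uv(1)] by simp
    show "1 \<le> u"
      using bd(1)[OF uv(1)] aN by (auto simp: shift_def split: if_splits)
    show "v \<le> n"
      using bd(3)[OF uv(1)] uv(2) aN N by (auto simp: shift_def split: if_splits)
  qed
  have Dom: "shift a u \<in> Domain F" if "u \<in> Domain E" for u
    using that by (auto simp: E_def)
  have Ran: "shift a v \<in> Range F" if "v \<in> Range E" for v
    using that by (auto simp: E_def)
  have aDom: "a \<in> Domain F"
    using a by auto
  have noRan: "v \<notin> Range E" if "Suc v = a" for v
  proof
    assume "v \<in> Range E"
    then have "v \<in> Range F"
      using Ran[of v] that by (simp add: shift_def)
    then show False
      using D(3) that aDom by blast
  qed
  have arc: "arc_diagram n E"
    unfolding arc_diagram_def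
  proof (intro conjI)
    show "\<forall>(i, j)\<in>E. 1 \<le> i \<and> i < j \<and> j \<le> n"
      using bdE by auto
    show "single_valued E"
      using arc_diagram_right_unique[OF D(1)] by (fastforce simp: E_def single_valued_def)
    show "single_valued (E\<inverse>)"
      using arc_diagram_left_unique[OF D(1)] by (fastforce simp: E_def single_valued_def)
  qed
  moreover have "Domain E \<inter> Range E = {}"
    using Dom Ran D(2) by blast
  moreover have "Suc j \<notin> Domain E" if j: "j \<in> Range E" for j
  proof
    assume "Suc j \<in> Domain E"
    then have "shift a (Suc j) \<in> Domain F" "Suc j \<noteq> a"
      using Dom noRan j by auto
    then show False
      using D(3)[OF Ran[OF j]] Suc_shift_eq[of a j "Suc j"] by simp
  qed
  moreover have aE: "a \<notin> Domain E"
  proof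
    assume "a \<in> Domain E"
    then obtain v where "(Suc a, shift a v) \<in> F"
      by (auto simp: E_def shift_def)
    then have "N < shift a v" "shift a v \<le> N"
      using D(4)[OF a] bd(3) by auto
    then show False
      by simp
  qed
  moreover have "j < j'" if ij: "(i, j) \<in> E" "(Suc i, j') \<in> E" for i j j'
  proof -
    have "Suc i \<noteq> a"
      using aE ij(2) by auto
    then have "shift a (Suc i) = Suc (shift a i)"
      using Suc_shift_eq[of a i "Suc i"] by simp
    then show ?thesis
      using D(4)[of "shift a i" "shift a j" "shift a j'"] ij by (simp add: E_def)
  qed
  moreover have "i' < i" if ij: "(i', j) \<in> E" "(i, Suc j) \<in> E" for i i' j
  proof -
    have "Suc j \<noteq> a"
      using noRan ij(1) by blast
    then have "shift a (Suc j) = Suc (shift a j)"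
      using Suc_shift_eq[of a j "Suc j"] by simp
    then show ?thesis
      using D(5)[of "shift a i'" "shift a j" "shift a i"] ij by (simp add: E_def)
  qed
  ultimately have "matching_diagram n E"
    by (auto simp: matching_diagram_def no_right_nesting_def)
  moreover have "a \<in> matching_slots (E, n)"
    using aN aE noRan[of "a - 1"] by (auto simp: matching_slots_def)
  moreover have "\<not> is_low (E, n) a"
  proof
    assume "is_low (E, n) a"
    then obtain i where i: "(i, n) \<in> E" "a \<le> i"
      by (auto simp: is_low_def)
    then have "a \<le> n"
      using bdE(2)[OF i(1)] by simp
    then have "shift a n = Suc n"
      by (simp add: shift_def)
    then have "(shift a i, Suc n) \<in> F"
      using i by (simp add: E_def)
    then have "shift a i < a"
      using D(5)[of "shift a i" "Suc n" a] a N by simp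
    then show False
      using i(2) by simp
  qed
  ultimately show ?thesis
    using that N F_eq by blast
qed

text \<open>Each slot survives at its shifted place, and the used one now stands directly behind the
  new opener.\<close>

lemma matching_slots_insert_arc:
  assumes E: "matching_diagram n E" and a: "a \<in> matching_slots (E, n)"
  shows "matching_slots (insert_arc a n E, Suc (Suc n)) = shift a ` matching_slots (E, n)"
proof -
  let ?F = "insert_arc a n E" and ?N = "Suc (Suc n)"
  note D = matching_diagramD[OF E]
  have v: "x \<in> Domain E \<Longrightarrow> 1 \<le> x \<and> x < n" "x \<in> Range E \<Longrightarrow> 1 < x \<and> x \<le> n" for x
    using diagram_vertices[OF D(1)] by auto
  have a': "1 \<le> a" "a \<le> Suc n" "a - 1 \<notin> Range E" "a \<notin> Domain E"
    using a by (auto simp: matching_slots_def)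
  have key: "shift a b \<in> matching_slots (?F, ?N) \<longleftrightarrow> b \<in> matching_slots (E, n)" for b
  proof -
    have "shift a b - 1 \<in> Range ?F \<longleftrightarrow> b - 1 \<in> Range E" if b: "1 \<le> b" "b \<le> Suc n"
    proof -
      consider "b < a" | "b = a" | "b > a"
        by linarith
      then show ?thesis
      proof cases
        case 1
        then have "shift a b - 1 = shift a (b - 1)"
          by (simp add: shift_def)
        moreover have "shift a (b - 1) \<noteq> ?N"
          using 1 b by (auto simp: shift_def)
        ultimately show ?thesis
          by (simp add: insert_arc_Range)
      next
        case 2
        then show ?thesis
          using a' by (auto simp: insert_arc_Range shift_def)
      next
        case 3
        then have "shift a b - 1 = shift a (b - 1)"
          by (auto simp: shift_def)
        moreover have "shift a (b - 1) \<noteq> ?N"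
          using 3 b by (auto simp: shift_def)
        ultimately show ?thesis
          by (simp add: insert_arc_Range)
      qed
    qed
    moreover have "shift a b \<in> Domain ?F \<longleftrightarrow> b \<in> Domain E"
      by (simp add: insert_arc_Domain)
    moreover have "shift a b \<in> {1..Suc ?N} \<longleftrightarrow> b \<in> {1..?N}"
      using a' by (auto simp: shift_def)
    \<comment> \<open>The position after the new closer is a further candidate; it follows a closer
      and so is no slot.\<close>
    moreover have "shift a ?N - 1 \<in> Range ?F"
      using a' by (simp add: insert_arc_Range shift_def)
    ultimately show ?thesis
      by (cases "b = ?N") (auto simp: matching_slots_def)
  qed
  show ?thesis
  proof (intro equalityI subsetI)
    fix x assume x: "x \<in> matching_slots (?F, ?N)"
    then have "x \<noteq> a"
      by (auto simp: matching_slots_def insert_arc_Domain)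
    then show "x \<in> shift a ` matching_slots (E, n)"
      using x key shift_surj by (metis image_eqI)
  next
    fix x assume "x \<in> shift a ` matching_slots (E, n)"
    then show "x \<in> matching_slots (?F, ?N)"
      by (elim imageE) (simp only: key)
  qed
qed

text \<open>Before the insertion \<open>a\<close> is not an opener. So no old pair is torn apart,
  and the new opener is not followed by another one; at most it gains a pair with
  \<open>a - 1\<close>.\<close>

lemma opener_pairs_insert_arc:
  assumes "a \<in> matching_slots (E, n)"
  shows "opener_pairs (insert_arc a n E) =
    shift a ` opener_pairs E \<union> (if a - 1 \<in> Domain E then {a - 1} else {})"
proof -
  have a: "1 \<le> a" "a \<notin> Domain E"
    using assms by (auto simp: matching_slots_def)
  have "x \<in> opener_pairs (insert_arc a n E) \<longleftrightarrow>
      x \<in> shift a ` opener_pairs E \<union> (if a - 1 \<in> Domain E then {a - 1} else {})" for x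
  proof (cases "x = a")
    case True
    then show ?thesis
      using a by (auto simp: opener_pairs_def insert_arc_Domain Suc_cut_eq_shift)
  next
    case False
    then obtain u where u: "x = shift a u"
      using shift_surj by blast
    show ?thesis
    proof (cases "Suc u = a")
      case True
      then have "x = u" "a - 1 = u" "Suc x = a"
        using u by (auto simp: shift_def)
      then show ?thesis
        using True u a by (auto simp: opener_pairs_def insert_arc_Domain)
    next
      case False
      then have "Suc x = shift a (Suc u)" "x \<noteq> a - 1"
        using u a by (auto simp: shift_def)
      then show ?thesis
        using u by (simp add: opener_pairs_def insert_arc_Domain)
    qed
  qed
  then show ?thesis
    by blast
qed

lemma card_insert_arc:
  assumes "matching_diagram n E"
  shows "card (insert_arc a n E) = Suc (card E)"
proof -
  have "inj_on (map_prod (shift a) (shift a)) E"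
    by (auto simp: inj_on_def)
  moreover have "(a, Suc (Suc n)) \<notin> map_prod (shift a) (shift a) ` E"
    by auto
  ultimately show ?thesis
    using arc_diagram_finite[OF matching_diagramD(1)[OF assms]]
    by (simp add: insert_arc_def card_image)
qed

lemma insert_arc_inj:
  assumes "matching_diagram n E" "matching_diagram n E'" "insert_arc a n E = insert_arc a' n E'"
    "a \<in> matching_slots (E, n)" "a' \<in> matching_slots (E', n)"
  shows "a = a'" "E = E'"
proof -
  have no: "shift b v \<noteq> Suc (Suc n)" if "(u, v) \<in> F" "matching_diagram n F" for b u v F
    using arc_diagramD(3)[OF matching_diagramD(1)[OF that(2)] that(1)] by (auto simp: shift_def)
  have "(a, Suc (Suc n)) \<in> insert_arc a' n E'"
    using assms(3)[symmetric] by (simp add: in_insert_arc)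
  then show "a = a'"
    using no[OF _ assms(2)] by (metis in_insert_arc)
  then have "(u, v) \<in> E \<longleftrightarrow> (u, v) \<in> E'" for u v
    using assms(3) in_insert_arc[of "shift a u" "shift a v" a n E] in_insert_arc[of "shift a u" "shift a v" a n E']
    by simp
  then show "E = E'"
    by auto
qed

text \<open>Needed at the start of growth: before any letter a matching state has as many vertices
  as arcs. The openers are distinct and smaller than \<open>n\<close>, so only the empty diagram is
  left.\<close>

lemma card_arc_diagram_less:
  assumes "arc_diagram n E" "E \<noteq> {}"
  shows "card E < n"
proof -
  have "inj_on fst E"
    using arc_diagram_right_unique[OF assms(1)] by (auto simp: inj_on_def)
  then have "card E = card (fst ` E)"
    by (simp add: card_image)
  also have "\<dots> \<le> card {1..<n}"
    using arc_diagramD[OF assms(1)] by (intro card_mono) fastforce+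
  also have "\<dots> < n"
    using arc_diagramD[OF assms(1)] assms(2) by fastforce
  finally show ?thesis .
qed

section \<open>Growing matchings\<close>

text \<open>Shifting keeps the slots in order, so labels stay in place and the relabelling is the
  identity. A slot is flagged when an opener stands just before it; for the slot 1 the value
  \<open>b - 1\<close> is 0, which is no vertex, so it is unflagged.\<close>

interpretation matching: growth_system matching_states "({}, 0)" matching_slots is_low matching_gr
  "\<lambda>(E, n) b. b - 1 \<in> Domain E" "\<lambda>(E, n). card (opener_pairs E)" "\<lambda>(E, n). card E" "\<lambda>p L. L"
proof (unfold_locales, goal_cases)
  case 1
  then show ?case by (simp add: relabelling_def)
next
  case 2
  show ?case
  proof (intro equalityI subsetI)
    fix s assume "s \<in> matching_states 0"
    then obtain E where E: "s = (E, card E)" "matching_diagram (card E) E"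
      by (auto simp: matching_states_def)
    then have "E = {}"
      using card_arc_diagram_less[OF matching_diagramD(1)[OF E(2)]] by blast
    then show "s \<in> {({}, 0)}"
      using E(1) by simp
  next
    fix s :: "(nat \<times> nat) set \<times> nat" assume "s \<in> {({}, 0)}"
    then show "s \<in> matching_states 0"
      by (simp add: matching_states_def matching_diagram_def arc_diagram_empty no_right_nesting_def)
  qed
next
  case 3
  have "matching_slots ({}, 0) = {1}"
    by (auto simp: matching_slots_def)
  then show ?case by simp
next
  case (4 b)
  then show ?case by (simp add: is_low_def)
next
  case (5 b)
  then show ?case by simp
next
  case 6
  then show ?case by (simp add: opener_pairs_def)
next
  case 7
  then show ?case by simp
next
  case (8 s l)
  then show ?case by (cases s) (simp add: matching_slots_def)
next
  case (9 s b a)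
  then show ?case by (auto simp: is_low_def)
next
  case (10 s' l)
  obtain F N where F: "s' = (F, N)" "matching_diagram N F" "N = Suc l + card F"
    using 10 by (auto simp: matching_states_def)
  show ?case
  proof (cases "N \<in> Range F")
    case False
    let ?n = "l + card F"
    have "arc_diagram ?n F"
      using F matching_diagramD(1)[OF F(2)] arc_diagram_shrink[of ?n F] False by simp
    then have "(F, ?n) \<in> matching_states l"
      using F(2) by (simp add: matching_states_def matching_diagram_def)
    moreover have "s' = matching_gr (F, ?n) None"
      using F by (simp add: matching_gr_def)
    ultimately show ?thesis
      by blast
  next
    case True
    then obtain a where "(a, N) \<in> F"
      by auto
    then obtain E n where E: "N = Suc (Suc n)" "F = insert_arc a n E" "matching_diagram n E"
        "a \<in> matching_slots (E, n)" "\<not> is_low (E, n) a"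
      using matching_diagram_remove_arc[OF F(2)] by blast
    then have "(E, n) \<in> matching_states l"
      using F(3) card_insert_arc[OF E(3), of a] by (simp add: matching_states_def)
    moreover have "s' = matching_gr (E, n) (Some a)"
      using F E by (simp add: matching_gr_def)
    ultimately show ?thesis
      using E(4,5) by blast
  qed
next
  case (11 s l s')
  then show ?case by (cases s; cases s') (simp add: matching_gr_def)
next
  case (12 s l s' a a')
  obtain E n where s: "s = (E, n)" "matching_diagram n E"
    using 12 by (auto simp: matching_states_def)
  moreover obtain E' n' where s': "s' = (E', n')" "matching_diagram n' E'"
    using 12 by (auto simp: matching_states_def)
  moreover have "n = n'"
    using 12(5) s s' by (simp add: matching_gr_def)
  ultimately show ?case
    using 12 insert_arc_inj[of n E E' a a'] by (simp add: matching_gr_def)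
next
  case (13 s l s' a)
  obtain E n where s: "s = (E, n)" "matching_diagram n E"
    using 13 by (auto simp: matching_states_def)
  obtain E' n' where s': "s' = (E', n')"
    by force
  have "(a, Suc n) \<notin> E"
    using arc_diagramD(3)[OF matching_diagramD(1)[OF s(2)]] by fastforce
  then show ?case
    using s s' by (auto simp: matching_gr_def insert_arc_def)
next
  case (14 s l)
  obtain E n where s: "s = (E, n)" "n = l + card E" "matching_diagram n E"
    using 14 by (auto simp: matching_states_def)
  note D = matching_diagramD[OF s(3)]
  have v: "Suc n \<notin> Domain E" "Suc n \<notin> Range E" "Suc (Suc n) \<notin> Domain E"
    using diagram_vertices[OF D(1)] by fastforce+
  then have sl: "matching_slots (E, Suc n) = insert (Suc (Suc n)) (matching_slots (E, n))"
    by (auto simp: matching_slots_def le_Suc_eq)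
  have "sorted_list_of_set (insert (Suc (Suc n)) (matching_slots (E, n))) =
      sorted_list_of_set (matching_slots (E, n)) @ [Suc (Suc n)]"
    by (rule sorted_list_of_set_append) (auto simp: matching_slots_def)
  moreover have "Suc (Suc n) \<notin> matching_slots (E, n)" "finite (matching_slots (E, n))"
    by (auto simp: matching_slots_def)
  moreover have "(E, Suc n) \<in> matching_states (Suc l)"
    using s arc_diagram_mono[OF D(1)] by (simp add: matching_states_def matching_diagram_def)
  moreover have "\<not> is_low (E, Suc n) b" for b
    using v by (auto simp: is_low_def)
  moreover have "matching_gr (E, n) None = (E, Suc n)"
    by (simp add: matching_gr_def)
  ultimately show ?case
    using s(1) v by (simp only: sl) simp
next
  case (15 s l a)
  obtain E n where s: "s = (E, n)" "n = l + card E" "matching_diagram n E"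
    using 15 by (auto simp: matching_states_def)
  note D = matching_diagramD[OF s(3)]
  have a: "a \<in> matching_slots (E, n)" "\<not> is_low (E, n) a"
    using 15 s by simp_all
  have a': "1 \<le> a" "a \<notin> Domain E"
    using a by (auto simp: matching_slots_def)
  let ?F = "insert_arc a n E" and ?N = "Suc (Suc n)"
  have "(?F, ?N) \<in> matching_states (Suc l)"
    using matching_diagram_insert_arc[OF s(3) a] card_insert_arc[OF s(3)] s(2)
    by (simp add: matching_states_def)
  moreover have sl: "matching_slots (?F, ?N) = shift a ` matching_slots (E, n)"
    using matching_slots_insert_arc[OF s(3) a(1)] .
  moreover have "card (shift a ` matching_slots (E, n)) = card (matching_slots (E, n))"
    by (simp add: card_image inj_on_def)
  moreover have "card {b\<in>matching_slots (?F, ?N). is_low (?F, ?N) b} = card {b\<in>matching_slots (E, n). b < a}"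
  proof -
    have "\<exists>v. Suc (Suc n) = shift a v \<and> v \<in> Range E \<Longrightarrow> False"
      using diagram_vertices(2)[OF D(1)] by (fastforce simp: shift_def split: if_splits)
    then have "is_low (?F, ?N) b \<longleftrightarrow> b \<le> a" for b
      by (auto simp: is_low_def in_insert_arc)
    \<comment> \<open>The used slot moves from \<open>a\<close> to \<open>a + 1\<close> and is not
      low, so the next closer may use it again.\<close>
    moreover have "shift a b \<le> a \<longleftrightarrow> b < a" for b
      by (simp add: shift_def)
    ultimately have "{b\<in>matching_slots (?F, ?N). is_low (?F, ?N) b} = shift a ` {b\<in>matching_slots (E, n). b < a}"
      unfolding sl by auto
    then show ?thesis
      by (simp add: card_image inj_on_def)
  qed
  moreover have "card (opener_pairs ?F) = card (opener_pairs E) + (if a - 1 \<in> Domain E then 1 else 0)"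
  proof -
    have "finite (opener_pairs E)"
      using arc_diagram_finite[OF D(1)] by (auto simp: opener_pairs_def intro: finite_subset[OF _ finite_Domain])
    \<comment> \<open>An old pair whose first opener is moved to \<open>a - 1\<close> would have
      that opener there before the insertion too, and hence an opener at \<open>a\<close>.\<close>
    moreover have "a - 1 \<notin> shift a ` opener_pairs E"
    proof
      assume "a - 1 \<in> shift a ` opener_pairs E"
      then obtain u where "a - 1 = shift a u" "Suc u \<in> Domain E"
        by (auto simp: opener_pairs_def)
      then show False
        using a' by (auto simp: shift_def split: if_splits)
    qed
    ultimately show ?thesis
      unfolding opener_pairs_insert_arc[OF a(1)] by (simp add: card_image inj_on_def)
  qed
  moreover have "matching_gr (E, n) (Some a) = (?F, ?N)"
    by (simp add: matching_gr_def)
  ultimately show ?case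
    using s(1) card_insert_arc[OF s(3)] by simp
next
  case (16 s l p L H s')
  obtain E n where s: "s = (E, n)" "matching_diagram n E"
    using 16 by (auto simp: matching_states_def)
  let ?xs = "sorted_list_of_set (matching_slots (E, n))"
  define a where "a = ?xs ! p"
  have fin: "finite (matching_slots (E, n))"
    by (auto simp: matching_slots_def)
  have p: "p < card (matching_slots (E, n))"
    using 16 s by simp
  have a: "a \<in> matching_slots (E, n)"
    using sorted_list_of_set_nth(1)[OF fin p] by (simp add: a_def)
  then have a': "1 \<le> a"
    by (auto simp: matching_slots_def)
  have sorted: "sorted_list_of_set (matching_slots (insert_arc a n E, Suc (Suc n))) = map (shift a) ?xs"
    unfolding matching_slots_insert_arc[OF s(2) a] by (rule sorted_list_of_set_image[OF fin shift_strict_mono])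
  have flags: "map (\<lambda>b. b - 1 \<in> Domain E) ?xs = map (\<lambda>x. x \<in> H) L"
    using 16 s by simp
  have L: "distinct L" "length L = length ?xs"
    using 16 s by simp_all
  have shift_flag: "shift a b - 1 \<in> Domain (insert_arc a n E) \<longleftrightarrow> b = a \<or> b - 1 \<in> Domain E" if "1 \<le> b" for b
  proof (cases "b = a")
    case True
    then show ?thesis
      by (simp add: insert_arc_Domain shift_def)
  next
    case False
    then have "shift a b - 1 = shift a (b - 1)"
      using that by (auto simp: shift_def)
    then show ?thesis
      using False by (simp add: insert_arc_Domain)
  qed
  have "map (\<lambda>b. b - 1 \<in> Domain (insert_arc a n E)) (map (shift a) ?xs) = map (\<lambda>x. x \<in> insert (L ! p) H) L"
  proof (rule nth_equalityI)
    fix i assume "i < length (map (\<lambda>b. b - 1 \<in> Domain (insert_arc a n E)) (map (shift a) ?xs))"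
    then have i: "i < length ?xs"
      by simp
    then have "?xs ! i \<in> matching_slots (E, n)"
      using nth_mem[OF i] set_sorted_list_of_set[OF fin] by simp
    then have "1 \<le> ?xs ! i"
      by (auto simp: matching_slots_def)
    moreover have "?xs ! i - 1 \<in> Domain E \<longleftrightarrow> L ! i \<in> H"
    proof -
      have "map (\<lambda>b. b - 1 \<in> Domain E) ?xs ! i = map (\<lambda>x. x \<in> H) L ! i"
        using flags by simp
      then show ?thesis
        using i L by simp
    qed
    moreover have "?xs ! i = a \<longleftrightarrow> i = p" "L ! i = L ! p \<longleftrightarrow> i = p"
      using i p L by (simp_all add: a_def nth_eq_iff_index_eq)
    ultimately show "map (\<lambda>b. b - 1 \<in> Domain (insert_arc a n E)) (map (shift a) ?xs) ! i =
        map (\<lambda>x. x \<in> insert (L ! p) H) L ! i"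
      using shift_flag i L by simp
  qed (use L in simp)
  moreover have "s' = (insert_arc a n E, Suc (Suc n))"
    using 16(6) s(1) by (simp add: matching_gr_def a_def)
  ultimately show ?case
    using sorted by simp
qed

section \<open>The bijection\<close>

text \<open>Turns the equidistribution of the used labels into a bijection on words, by choosing any
  bijection between fibres of equal size.\<close>

lemma bij_betw_if_fibers:
  assumes "finite A" "finite B" "\<And>d. card {a\<in>A. h a = d} = card {b\<in>B. h' b = d}"
  obtains f where "bij_betw f A B" "\<And>a. a \<in> A \<Longrightarrow> h' (f a) = h a"
proof -
  have "\<exists>f. bij_betw f {a\<in>A. h a = d} {b\<in>B. h' b = d}" for d
    using assms by (intro finite_same_card_bij) auto
  then obtain F where F: "\<And>d. bij_betw (F d) {a\<in>A. h a = d} {b\<in>B. h' b = d}"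
    by metis
  define f where "f a = F (h a) a" for a
  have f: "f a \<in> B" "h' (f a) = h a" if "a \<in> A" for a
    using bij_betwE[OF F[of "h a"]] that by (auto simp: f_def)
  have "inj_on f A"
  proof (rule inj_onI)
    fix a a' assume aa: "a \<in> A" "a' \<in> A" "f a = f a'"
    then have "h a = h a'"
      using f by metis
    then show "a = a'"
      using aa bij_betw_imp_inj_on[OF F[of "h a"]] by (auto simp: f_def dest: inj_onD)
  qed
  moreover have "f ` A = B"
  proof (intro equalityI subsetI)
    fix b assume "b \<in> B"
    then have "b \<in> F (h' b) ` {a\<in>A. h a = h' b}"
      using bij_betw_imp_surj_on[OF F[of "h' b"]] by blast
    then obtain a where "a \<in> A" "h a = h' b" "b = F (h' b) a"
      by blast
    then show "b \<in> f ` A"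
      by (intro image_eqI[of _ _ a]) (simp_all add: f_def)
  qed (use f in blast)
  ultimately show ?thesis
    using that f by (auto simp: bij_betw_def)
qed

section \<open>The forbidden patterns as conditions on consecutive vertices\<close>

lemma no_right_nesting_iff:
  assumes "arc_diagram m E"
  shows "(\<forall>a\<in>E. \<forall>b\<in>E. \<not> right_nesting a b) \<longleftrightarrow> no_right_nesting E"
proof
  assume R: "\<forall>a\<in>E. \<forall>b\<in>E. \<not> right_nesting a b"
  show "no_right_nesting E"
    unfolding no_right_nesting_def
  proof (intro allI impI)
    fix i i' j assume ij: "(i', j) \<in> E" "(i, Suc j) \<in> E"
    then have "\<not> i < i'"
      using R arc_diagramD(2)[OF assms ij(1)] by fastforce
    moreover have "i \<noteq> i'"
      using arc_diagram_right_unique[OF assms ij(1)] ij(2) by force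
    ultimately show "i' < i"
      by simp
  qed
next
  assume R: "no_right_nesting E"
  have "\<not> right_nesting (i1, j1) (i2, j2)" if "(i1, j1) \<in> E" "(i2, j2) \<in> E" for i1 j1 i2 j2
  proof
    assume nest: "right_nesting (i1, j1) (i2, j2)"
    then have "(i1, Suc j2) \<in> E"
      using that(1) by auto
    then have "i2 < i1"
      using R that(2) unfolding no_right_nesting_def by blast
    then show False
      using nest by simp
  qed
  then show "\<forall>a\<in>E. \<forall>b\<in>E. \<not> right_nesting a b"
    by auto
qed

lemma no_left_nesting_iff:
  assumes "arc_diagram m E"
  shows "(\<forall>a\<in>E. \<forall>b\<in>E. \<not> left_nesting a b) \<longleftrightarrow>
    (\<forall>i j j'. (i, j) \<in> E \<longrightarrow> (Suc i, j') \<in> E \<longrightarrow> j < j')"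
proof
  assume L: "\<forall>a\<in>E. \<forall>b\<in>E. \<not> left_nesting a b"
  show "\<forall>i j j'. (i, j) \<in> E \<longrightarrow> (Suc i, j') \<in> E \<longrightarrow> j < j'"
  proof (intro allI impI)
    fix i j j' assume ij: "(i, j) \<in> E" "(Suc i, j') \<in> E"
    then have "\<not> j' < j"
      using L arc_diagramD(2)[OF assms ij(2)] by fastforce
    moreover have "j \<noteq> j'"
      using arc_diagram_left_unique[OF assms ij(1)] ij(2) by force
    ultimately show "j < j'"
      by simp
  qed
next
  assume L: "\<forall>i j j'. (i, j) \<in> E \<longrightarrow> (Suc i, j') \<in> E \<longrightarrow> j < j'"
  have "\<not> left_nesting (i1, j1) (i2, j2)" if "(i1, j1) \<in> E" "(i2, j2) \<in> E" for i1 j1 i2 j2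
  proof
    assume nest: "left_nesting (i1, j1) (i2, j2)"
    then have "(Suc i1, j2) \<in> E"
      using that(2) by auto
    then have "j1 < j2"
      using L that(1) by blast
    then show False
      using nest by simp
  qed
  then show "\<forall>a\<in>E. \<forall>b\<in>E. \<not> left_nesting a b"
    by auto
qed

lemma no_neighbor_alignment_iff:
  assumes "arc_diagram m E"
  shows "(\<forall>a\<in>E. \<forall>b\<in>E. \<not> neighbor_alignment a b) \<longleftrightarrow> (\<forall>j\<in>Range E. Suc j \<notin> Domain E)"
proof
  assume N: "\<forall>a\<in>E. \<forall>b\<in>E. \<not> neighbor_alignment a b"
  show "\<forall>j\<in>Range E. Suc j \<notin> Domain E"
  proof (intro ballI notI)
    fix j assume "j \<in> Range E" "Suc j \<in> Domain E"
    then obtain i k where ij: "(i, j) \<in> E" "(Suc j, k) \<in> E"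
      by blast
    then have "neighbor_alignment (i, j) (Suc j, k)"
      using arc_diagramD(2)[OF assms] by simp
    then show False
      using N ij by blast
  qed
next
  assume N: "\<forall>j\<in>Range E. Suc j \<notin> Domain E"
  have "\<not> neighbor_alignment (i1, j1) (i2, j2)" if "(i1, j1) \<in> E" "(i2, j2) \<in> E" for i1 j1 i2 j2
  proof
    assume "neighbor_alignment (i1, j1) (i2, j2)"
    then have "i2 = Suc j1"
      by simp
    then show False
      using N that by blast
  qed
  then show "\<forall>a\<in>E. \<forall>b\<in>E. \<not> neighbor_alignment a b"
    by auto
qed

lemma R_matchings_iff:
  "M \<in> R_matchings n k \<longleftrightarrow> set_partition n M \<and> matching_diagram n (arcs M) \<and> card (arcs M) = k"
proof (cases "set_partition n M")
  case True
  note arc = arc_diagram_arcs[OF True]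
  have "M \<in> R_matchings n k \<longleftrightarrow> partial_matching n M \<and> card (arcs M) = k \<and>
      (\<forall>a\<in>arcs M. \<forall>b\<in>arcs M. \<not> neighbor_alignment a b) \<and>
      (\<forall>a\<in>arcs M. \<forall>b\<in>arcs M. \<not> left_nesting a b) \<and>
      (\<forall>a\<in>arcs M. \<forall>b\<in>arcs M. \<not> right_nesting a b)"
    unfolding R_matchings_def mem_Collect_eq by blast
  then show ?thesis
    unfolding no_right_nesting_iff[OF arc] no_left_nesting_iff[OF arc] no_neighbor_alignment_iff[OF arc]
      partial_matching_iff_no_transients[OF True] transients_eq[OF True] matching_diagram_def
    using True arc by argo
next
  case False
  then show ?thesis
    by (simp add: R_matchings_def partial_matching_def)
qed

lemma T_partitions_iff:
  "P \<in> T_partitions m k \<longleftrightarrow> set_partition m P \<and> no_right_nesting (arcs P) \<and> card (arcs P) = k"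
proof (cases "set_partition m P")
  case True
  then show ?thesis
    unfolding T_partitions_def mem_Collect_eq no_right_nesting_iff[OF arc_diagram_arcs[OF True]] by argo
qed (simp add: T_partitions_def)

text \<open>Arcs opening at \<open>i\<close> and \<open>i + 1\<close> cross or nest unless the first
  one ends at \<open>i + 1\<close>. The nesting is forbidden, and ending there would make
  \<open>i + 1\<close> a transient; so \<open>i\<close> determines a left crossing.\<close>

lemma num_left_crossings_eq:
  assumes "matching_diagram n (arcs M)"
  shows "num_left_crossings M = card (opener_pairs (arcs M))"
proof -
  let ?E = "arcs M"
  let ?C = "{(a, b). a \<in> ?E \<and> b \<in> ?E \<and> left_crossing a b}"
  note D = matching_diagramD[OF assms]
  have "bij_betw (\<lambda>(a, b). fst a) ?C (opener_pairs ?E)"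
    unfolding bij_betw_def
  proof
    show "inj_on (\<lambda>(a, b). fst a) ?C"
    proof (rule inj_onI, clarsimp)
      fix i j j1 j' j1'
      assume "(i, j) \<in> ?E" "(Suc i, j1) \<in> ?E" "(i, j') \<in> ?E" "(Suc i, j1') \<in> ?E"
      then show "j = j' \<and> j1 = j1'"
        using arc_diagram_right_unique[OF D(1)] by blast
    qed
    show "(\<lambda>(a, b). fst a) ` ?C = opener_pairs ?E"
    proof (intro equalityI subsetI)
      fix i assume "i \<in> (\<lambda>(a, b). fst a) ` ?C"
      then show "i \<in> opener_pairs ?E"
        by (force simp: opener_pairs_def)
    next
      fix i assume "i \<in> opener_pairs ?E"
      then obtain j j' where ij: "(i, j) \<in> ?E" "(Suc i, j') \<in> ?E"
        by (auto simp: opener_pairs_def)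
      have "i < j" "j < j'"
        using arc_diagramD(2)[OF D(1) ij(1)] D(4)[OF ij] by simp_all
      moreover have "Suc i \<noteq> j"
        using D(2)[of "Suc i"] ij by blast
      ultimately have "((i, j), (Suc i, j')) \<in> ?C"
        using ij by simp
      then show "i \<in> (\<lambda>(a, b). fst a) ` ?C"
        by force
    qed
  qed
  then show ?thesis
    by (simp add: num_left_crossings_def bij_betw_same_card)
qed

section \<open>The two families as states of the growth systems\<close>

lemma bij_betw_R_matchings:
  assumes "k \<le> n"
  shows "bij_betw (\<lambda>M. (arcs M, n)) (R_matchings n k)
    {s\<in>matching_states (n - k). (case s of (E, _) \<Rightarrow> card E) = k}"
proof -
  have "bij_betw arcs (R_matchings n k) {E. matching_diagram n E \<and> card E = k}"
  proof (rule bij_betw_subset[OF bij_betw_arcs[of n]])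
    show "R_matchings n k \<subseteq> {P. set_partition n P}"
      by (auto simp: R_matchings_iff)
    show "arcs ` R_matchings n k = {E. matching_diagram n E \<and> card E = k}"
    proof (intro equalityI subsetI)
      fix E assume "E \<in> {E. matching_diagram n E \<and> card E = k}"
      then have E: "matching_diagram n E" "card E = k"
        by auto
      then show "E \<in> arcs ` R_matchings n k"
        using arcs_diagram_blocks[OF matching_diagramD(1)[OF E(1)]]
          diagram_blocks_partition[OF matching_diagramD(1)[OF E(1)]]
        by (intro image_eqI[of _ _ "diagram_blocks n E"]) (simp_all add: R_matchings_iff)
    qed (auto simp: R_matchings_iff)
  qed
  moreover have "bij_betw (\<lambda>E. (E, n)) {E. matching_diagram n E \<and> card E = k}
      {s\<in>matching_states (n - k). (case s of (E, _) \<Rightarrow> card E) = k}"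
    using assms by (auto simp: bij_betw_def inj_on_def matching_states_def)
  ultimately show ?thesis
    using bij_betw_trans by (fastforce simp: comp_def)
qed

lemma bij_betw_T_partitions:
  "bij_betw (\<lambda>P. (arcs P, Suc l)) (T_partitions (Suc l) k)
    {s\<in>partition_states l. (case s of (E, _) \<Rightarrow> card E) = k}"
proof -
  let ?D = "{E. arc_diagram (Suc l) E \<and> no_right_nesting E \<and> card E = k}"
  have "bij_betw arcs (T_partitions (Suc l) k) ?D"
  proof (rule bij_betw_subset[OF bij_betw_arcs[of "Suc l"]])
    show "T_partitions (Suc l) k \<subseteq> {P. set_partition (Suc l) P}"
      by (auto simp: T_partitions_iff)
    show "arcs ` T_partitions (Suc l) k = ?D"
    proof (intro equalityI subsetI)
      fix E assume E: "E \<in> ?D"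
      then show "E \<in> arcs ` T_partitions (Suc l) k"
        using arcs_diagram_blocks[of "Suc l" E] diagram_blocks_partition[of "Suc l" E]
        by (intro image_eqI[of _ _ "diagram_blocks (Suc l) E"]) (simp_all add: T_partitions_iff)
    qed (auto simp: T_partitions_iff arc_diagram_arcs)
  qed
  moreover have "bij_betw (\<lambda>E. (E, Suc l)) ?D {s\<in>partition_states l. (case s of (E, _) \<Rightarrow> card E) = k}"
    by (auto simp: bij_betw_def inj_on_def partition_states_def)
  ultimately show ?thesis
    using bij_betw_trans by (fastforce simp: comp_def)
qed

theorem theorem5p1:
  fixes n k :: nat
  assumes "k \<le> n div 2"
  shows "\<exists>\<gamma>. bij_betw \<gamma> (R_matchings n k) (T_partitions (n - k + 1) k) \<and>
           (\<forall>M\<in>R_matchings n k. num_left_crossings M = card (transients (\<gamma> M)))"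
proof -
  define l where "l = n - k"
  \<comment> \<open>The number of \<open>None\<close> letters. It equals the number of singletons of
    the matching; the partition has one block more, owing to the initial slot.\<close>
  define c where "c = n - 2 * k"
  have lc: "c \<le> l" "l - c = k" "k \<le> n" "n - k + 1 = Suc l"
    using assms by (auto simp: l_def c_def)
  define V where "V = {ws\<in>growth_words l. num_runs ws = c}"
  let ?R = "\<lambda>M. (arcs M, n)" and ?T = "\<lambda>P. (arcs P, Suc l)"
  let ?SR = "{s\<in>matching_states l. (case s of (E, _) \<Rightarrow> card E) = k}"
    and ?ST = "{s\<in>partition_states l. (case s of (E, _) \<Rightarrow> card E) = k}"
  have R: "bij_betw ?R (R_matchings n k) ?SR"
    using bij_betw_R_matchings[OF lc(3)] by (simp add: l_def)
  have T: "bij_betw ?T (T_partitions (Suc l) k) ?ST"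
    by (rule bij_betw_T_partitions)
  have VR: "bij_betw matching.grow V ?SR" and VT: "bij_betw partition.grow V ?ST"
    using matching.bij_betw_grow_num_runs[OF lc(1)] partition.bij_betw_grow_num_runs[OF lc(1)]
    by (simp_all add: V_def lc(2))
  have fin: "finite V"
    by (rule finite_subset[OF _ finite_growth_words[of 1 0 l]]) (auto simp: V_def growth_words_def)
  have hits: "card {ws\<in>V. hit_labels (\<lambda>p L. L) ws = D} = card {ws\<in>V. hit_labels move_to_end ws = D}" for D
    using card_hit_labels_eq[OF matching.relab partition.relab, of l c D]
    by (simp add: V_def growth_words_def conj_assoc)
  obtain f where f: "bij_betw f V V"
      "\<And>ws. ws \<in> V \<Longrightarrow> hit_labels move_to_end (f ws) = hit_labels (\<lambda>p L. L) ws"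
    using bij_betw_if_fibers[OF fin fin hits] by blast
  define v where "v = inv_into V matching.grow \<circ> ?R"
  have v: "bij_betw v (R_matchings n k) V"
    unfolding v_def by (rule bij_betw_trans[OF R bij_betw_inv_into[OF VR]])
  define w where "w = inv_into (T_partitions (Suc l) k) ?T"
  \<comment> \<open>From a matching to its word, then to a word with the same used labels under the
    other relabelling, then to the partition which that word grows.\<close>
  define \<gamma> where "\<gamma> = ((w \<circ> partition.grow) \<circ> f) \<circ> v"
  have w: "bij_betw w ?ST (T_partitions (Suc l) k)"
    unfolding w_def by (rule bij_betw_inv_into[OF T])
  have "bij_betw \<gamma> (R_matchings n k) (T_partitions (Suc l) k)"
    unfolding \<gamma>_def by (rule bij_betw_trans[OF v bij_betw_trans[OF f(1) bij_betw_trans[OF VT w]]])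
  moreover have "num_left_crossings M = card (transients (\<gamma> M))" if M: "M \<in> R_matchings n k" for M
  proof -
    have vM: "v M \<in> V"
      using bij_betwE[OF v] M by blast
    then have fv: "f (v M) \<in> V"
      using bij_betwE[OF f(1)] by blast
    have "?R M \<in> ?SR"
      using bij_betwE[OF R] M by blast
    then have "matching.grow (v M) = ?R M"
      unfolding v_def comp_apply by (rule bij_betw_inv_into_right[OF VR])
    then have "card (opener_pairs (arcs M)) = k - card (hit_labels (\<lambda>p L. L) (v M))"
      using matching.stat_grow[of "v M" l] vM lc(2) by (simp add: V_def)
    moreover have ST: "partition.grow (f (v M)) \<in> ?ST"
      using bij_betwE[OF VT] fv by blast
    then have "partition.grow (f (v M)) = ?T (\<gamma> M)"
      unfolding \<gamma>_def w_def comp_apply by (rule bij_betw_inv_into_right[OF T, symmetric])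
    then have "card (Domain (arcs (\<gamma> M)) \<inter> Range (arcs (\<gamma> M))) =
        k - card (hit_labels move_to_end (f (v M)))"
      using partition.stat_grow[of "f (v M)" l] fv lc(2) by (simp add: V_def)
    moreover have "\<gamma> M \<in> T_partitions (Suc l) k"
      using bij_betwE[OF w] ST unfolding \<gamma>_def comp_apply by blast
    then have "set_partition (Suc l) (\<gamma> M)"
      by (simp add: T_partitions_iff)
    ultimately show ?thesis
      using num_left_crossings_eq[of n M] M f(2)[OF vM] transients_eq[of "Suc l" "\<gamma> M"]
      by (simp add: R_matchings_iff)
  qed
  ultimately show ?thesis
    unfolding lc(4) by blast
qed

end
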